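(* There is a deterministic black-box identity testing algorithm for read-$k$ $\Sigma\Pi\Sigma(k,d)$ circuits in $n$ variables (an algorithm which, using only evaluations of the computed polynomial, correctly decides whether it is identically zero) running in time $O(n^{k^4\log k})$.
   Context: A $\Sigma\Pi\Sigma(k,d)$ circuit over a field $\mathbb{F}$ in variables $x_1,\dots,x_n$ computes $\sum_{i=1}^k \prod_{j=1}^{d}\ell_{i,j}$ with each $\ell_{i,j}$ a linear polynomial over $\mathbb{F}$; $k$ is the top fanin. It is read-$k$ if each variable occurs in at most $k$ of the linear functions (i.e. each variable appears at most $k$ times in the circuit).
   Formalization: The time bound is proved for k ≥ 2 and n ≥ 2 (for k = 1 it would be O(1), which is false; correctness still holds), and over small finite fields the polynomial is evaluated over an extension field with enough supplied distinct elements, since evaluations over F alone cannot suffice. *)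

theory Defs
  imports Complex_Main "HOL-Library.Poly_Mapping"
begin

section \<open>Polynomials and depth-3 circuits\<close>

text \<open>
  A monomial maps each variable index to its exponent. Multiplication of \<open>\<Rightarrow>\<^sub>0\<close> is convolution,
  so this type is the polynomial ring in the variables \<open>x\<^sub>0, x\<^sub>1, \<dots>\<close>; \<open>p = 0\<close> means that all
  coefficients vanish, not that all values do.
\<close>

type_synonym 'a mpoly = "(nat \<Rightarrow>\<^sub>0 nat) \<Rightarrow>\<^sub>0 'a"

definition mvar :: "nat \<Rightarrow> 'a::comm_ring_1 mpoly" where
  "mvar v = Poly_Mapping.single (Poly_Mapping.single v 1) 1"

definition mconst :: "'a::comm_ring_1 \<Rightarrow> 'a mpoly" where
  "mconst c = Poly_Mapping.single 0 c"

definition field_embedding :: "('a::field \<Rightarrow> 'b::field) \<Rightarrow> bool" where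
  "field_embedding \<iota> \<longleftrightarrow>
     \<iota> 1 = 1 \<and> (\<forall>x y. \<iota> (x + y) = \<iota> x + \<iota> y) \<and> (\<forall>x y. \<iota> (x * y) = \<iota> x * \<iota> y)"

text \<open>Evaluation at a point of an extension field, the coefficients being embedded by \<open>\<iota>\<close>.\<close>

definition meval :: "('a::field \<Rightarrow> 'b::field) \<Rightarrow> 'a mpoly \<Rightarrow> (nat \<Rightarrow> 'b) \<Rightarrow> 'b" where
  "meval \<iota> p x =
     (\<Sum>m\<in>Poly_Mapping.keys p.
        \<iota> (Poly_Mapping.lookup p m) *
        (\<Prod>v\<in>Poly_Mapping.keys m. x v ^ Poly_Mapping.lookup m v))"

text \<open>
  A linear polynomial is affine: \<open>lconst + (\<Sum>v<n. lcoeff v * x\<^sub>v)\<close>. It may be constant,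
  so products with fewer than \<open>d\<close> proper factors can be padded.
\<close>

record 'a linear_polynomial =
  lconst :: 'a
  lcoeff :: "nat \<Rightarrow> 'a"

definition linear_mpoly :: "nat \<Rightarrow> 'a::comm_ring_1 linear_polynomial \<Rightarrow> 'a mpoly" where
  "linear_mpoly n l = mconst (lconst l) + (\<Sum>v<n. mconst (lcoeff l v) * mvar v)"

text \<open>
  A \<open>\<Sigma>\<Pi>\<Sigma>(k,d)\<close> circuit in \<open>n\<close> variables is given by its linear polynomials \<open>c i j\<close> with
  \<open>i < k\<close> and \<open>j < d\<close>; entries outside this range, and coefficients of variables
  \<open>v \<ge> n\<close>, are ignored.
\<close>

type_synonym 'a depth3_circuit = "nat \<Rightarrow> nat \<Rightarrow> 'a linear_polynomial"

definition circuit_poly ::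
    "nat \<Rightarrow> nat \<Rightarrow> nat \<Rightarrow> 'a::comm_ring_1 depth3_circuit \<Rightarrow> 'a mpoly" where
  "circuit_poly k d n c = (\<Sum>i<k. \<Prod>j<d. linear_mpoly n (c i j))"

text \<open>Occurrences are counted over the whole circuit, and repeated factors count repeatedly.\<close>

definition read_at_most ::
    "nat \<Rightarrow> nat \<Rightarrow> nat \<Rightarrow> nat \<Rightarrow> 'a::comm_ring_1 depth3_circuit \<Rightarrow> bool" where
  "read_at_most r k d n c \<longleftrightarrow>
     (\<forall>v<n. card {(i, j). i < k \<and> j < d \<and> lcoeff (c i j) v \<noteq> 0} \<le> r)"


section \<open>Black-box algorithms\<close>

text \<open>
  The machine model is an algebraic random access machine: finite programs act on
  natural-number registers \<open>reg\<close>, an indirectly addressed memory \<open>nmem\<close> of natural numbers, and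
  an indirectly addressed memory \<open>fmem\<close> of field elements. Every instruction, test and oracle
  query costs one unit; there is no multiplication of natural numbers. Register names in a
  program are literals, and field operands are addressed through registers.

  A program contains no field constants except 0 and 1. It obtains further field elements
  from a sequence \<open>e\<close> supplied with the field, of which only the distinctness of sufficiently many
  values is known. If the circuit is over a small finite field, the oracle is queried over an
  extension such as its algebraic closure, and \<open>e\<close> may take values in a finite subfield of it.
\<close>

datatype test =
    Less nat nat        \<comment> \<open>compares registers\<close>
  | FieldEq nat nat     \<comment> \<open>compares the field cells addressed by two registers\<close>

datatype com =
    Skip
  | NatConst nat nat
  | NatCopy nat nat
  | NatAdd nat nat nat
  | NatSub nat nat nat  \<comment> \<open>truncated\<close>
  | NatLoad nat nat
  | NatStore nat nat
  | FieldZero nat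
  | FieldOne nat
  | FieldElem nat nat
  | FieldCopy nat nat
  | FieldAdd nat nat nat
  | FieldSub nat nat nat
  | FieldMul nat nat nat
  | FieldDiv nat nat nat \<comment> \<open>division by 0 yields 0\<close>
  | Query nat nat
  | Seq com com
  | Cond test com com
  | While test com

record 'f state =
  reg :: "nat \<Rightarrow> nat"
  nmem :: "nat \<Rightarrow> nat"
  fmem :: "nat \<Rightarrow> 'f"

fun holds :: "test \<Rightarrow> 'f state \<Rightarrow> bool" where
  "holds (Less a b) s \<longleftrightarrow> reg s a < reg s b"
| "holds (FieldEq a b) s \<longleftrightarrow> fmem s (reg s a) = fmem s (reg s b)"

definition set_reg :: "nat \<Rightarrow> nat \<Rightarrow> 'f state \<Rightarrow> 'f state" where
  "set_reg a x s = s\<lparr>reg := (reg s)(a := x)\<rparr>"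

definition set_cell :: "nat \<Rightarrow> 'f \<Rightarrow> 'f state \<Rightarrow> 'f state" where
  "set_cell a x s = s\<lparr>fmem := (fmem s)(reg s a := x)\<rparr>"

definition cell :: "'f state \<Rightarrow> nat \<Rightarrow> 'f" where
  "cell s a = fmem s (reg s a)"

text \<open>
  \<open>Query a b\<close> passes the consecutive field cells starting at address \<open>reg s b\<close> to the oracle as
  the coordinates of a point. An oracle for a polynomial in \<open>n\<close> variables depends only
  on the first \<open>n\<close> of them.
\<close>

fun atomic :: "(nat \<Rightarrow> 'f::field) \<Rightarrow> ((nat \<Rightarrow> 'f) \<Rightarrow> 'f) \<Rightarrow> com \<Rightarrow> 'f state \<Rightarrow> 'f state option"
where
  "atomic e f Skip s = Some s"
| "atomic e f (NatConst a x) s = Some (set_reg a x s)"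
| "atomic e f (NatCopy a b) s = Some (set_reg a (reg s b) s)"
| "atomic e f (NatAdd a b c) s = Some (set_reg a (reg s b + reg s c) s)"
| "atomic e f (NatSub a b c) s = Some (set_reg a (reg s b - reg s c) s)"
| "atomic e f (NatLoad a b) s = Some (set_reg a (nmem s (reg s b)) s)"
| "atomic e f (NatStore a b) s = Some (s\<lparr>nmem := (nmem s)(reg s a := reg s b)\<rparr>)"
| "atomic e f (FieldZero a) s = Some (set_cell a 0 s)"
| "atomic e f (FieldOne a) s = Some (set_cell a 1 s)"
| "atomic e f (FieldElem a b) s = Some (set_cell a (e (reg s b)) s)"
| "atomic e f (FieldCopy a b) s = Some (set_cell a (cell s b) s)"
| "atomic e f (FieldAdd a b c) s = Some (set_cell a (cell s b + cell s c) s)"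
| "atomic e f (FieldSub a b c) s = Some (set_cell a (cell s b - cell s c) s)"
| "atomic e f (FieldMul a b c) s = Some (set_cell a (cell s b * cell s c) s)"
| "atomic e f (FieldDiv a b c) s = Some (set_cell a (cell s b / cell s c) s)"
| "atomic e f (Query a b) s = Some (set_cell a (f (\<lambda>i. fmem s (reg s b + i))) s)"
| "atomic e f (Seq _ _) s = None"
| "atomic e f (Cond _ _ _) s = None"
| "atomic e f (While _ _) s = None"

text \<open>\<open>exec e f p s t s'\<close>: started in \<open>s\<close>, program \<open>p\<close> halts in \<open>s'\<close> after exactly \<open>t\<close> steps.\<close>

inductive exec ::
    "(nat \<Rightarrow> 'f::field) \<Rightarrow> ((nat \<Rightarrow> 'f) \<Rightarrow> 'f) \<Rightarrow> com \<Rightarrow> 'f state \<Rightarrow> nat \<Rightarrow> 'f state \<Rightarrow> bool"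
  for e :: "nat \<Rightarrow> 'f" and f :: "(nat \<Rightarrow> 'f) \<Rightarrow> 'f"
where
  atomic: "atomic e f p s = Some s' \<Longrightarrow> exec e f p s 1 s'"
| seq: "exec e f p s t s' \<Longrightarrow> exec e f q s' u s'' \<Longrightarrow> exec e f (Seq p q) s (t + u) s''"
| cond_true: "holds b s \<Longrightarrow> exec e f p s t s' \<Longrightarrow> exec e f (Cond b p q) s (Suc t) s'"
| cond_false: "\<not> holds b s \<Longrightarrow> exec e f q s t s' \<Longrightarrow> exec e f (Cond b p q) s (Suc t) s'"
| while_false: "\<not> holds b s \<Longrightarrow> exec e f (While b p) s 1 s"
| while_true: "holds b s \<Longrightarrow> exec e f p s t s' \<Longrightarrow> exec e f (While b p) s' u s''
    \<Longrightarrow> exec e f (While b p) s (Suc (t + u)) s''"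

inductive_cases exec_SeqE: "exec e f (Seq p q) s t s'"
inductive_cases exec_CondE: "exec e f (Cond b p q) s t s'"
inductive_cases exec_WhileE: "exec e f (While b p) s t s'"

lemma exec_deterministic:
  "exec e f p s t s' \<Longrightarrow> exec e f p s u s'' \<Longrightarrow> u = t \<and> s'' = s'"
proof (induction arbitrary: u s'' rule: exec.induct)
  case (atomic p s s')
  from atomic.prems show ?case by cases (use atomic.hyps in simp_all)
next
  case (seq p s t s' q v s2)
  from seq.prems obtain t1 s1 t2 where
    "exec e f p s t1 s1" "exec e f q s1 t2 s''" "u = t1 + t2"
    by - (erule exec_SeqE; simp)
  with seq.IH(1)[of t1 s1] seq.IH(2)[of t2 s''] show ?case by simp
next
  case (cond_true b s p t s' q)
  from cond_true.prems cond_true.hyps obtain t1 where "exec e f p s t1 s''" "u = Suc t1"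
    by - (erule exec_CondE; simp)
  with cond_true.IH[of t1 s''] show ?case by simp
next
  case (cond_false b s q t s' p)
  from cond_false.prems cond_false.hyps obtain t1 where "exec e f q s t1 s''" "u = Suc t1"
    by - (erule exec_CondE; simp)
  with cond_false.IH[of t1 s''] show ?case by simp
next
  case (while_false b s p)
  from while_false.prems while_false.hyps show ?case
    by - (erule exec_WhileE; simp)
next
  case (while_true b s p t s' v s2)
  from while_true.prems while_true.hyps obtain t1 s1 t2 where
    "exec e f p s t1 s1" "exec e f (While b p) s1 t2 s''" "u = Suc (t1 + t2)"
    by - (erule exec_WhileE; simp)
  with while_true.IH(1)[of t1 s1] while_true.IH(2)[of t2 s''] show ?case by simp
qed

text \<open>
  The program receives the parameters \<open>k\<close>, \<open>d\<close>, \<open>n\<close> in registers 0, 1, 2, and reports its answer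
  in register 0, where 1 stands for ``identically zero'' and 0 for ``not identically zero''.
  The circuit itself is not part of the initial state.
\<close>

definition initial_state :: "nat \<Rightarrow> nat \<Rightarrow> nat \<Rightarrow> 'f::field state" where
  "initial_state k d n =
     \<lparr>reg = (\<lambda>_. 0)(0 := k, 1 := d, 2 := n), nmem = (\<lambda>_. 0), fmem = (\<lambda>_. 0)\<rparr>"

definition halts_with ::
    "(nat \<Rightarrow> 'f::field) \<Rightarrow> ((nat \<Rightarrow> 'f) \<Rightarrow> 'f) \<Rightarrow> com \<Rightarrow> nat \<Rightarrow> nat \<Rightarrow> nat \<Rightarrow> nat \<Rightarrow> bool \<Rightarrow> bool"
where
  "halts_with e f p k d n t answer \<longleftrightarrow>
     (\<exists>s. exec e f p (initial_state k d n) t s \<and> reg s 0 = (if answer then 1 else 0))"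

end

theory Submission
  imports Defs "HOL-Computational_Algebra.Polynomial_Factorial"
begin

text \<open>
  Write the circuit polynomial as \<open>f = T\<^sub>1 + \<dots> + T\<^sub>m\<close> with nonzero products \<open>T\<^sub>i\<close> of affine forms, and let
  \<open>a\<close> be a point where no form vanishes. Some point \<open>a = (t, t\<^sup>2, \<dots>, t\<^sup>n)\<close> will do, since at most
  \<open>k n\<close> forms are nonconstant and each vanishes for at most \<open>n\<close> values of \<open>t\<close>. If \<open>f\<close> is not a
  multiple of \<open>T\<^sub>m\<close>, then for some coordinate shift \<open>s\<close> in a variable \<open>x\<^sub>v\<close> the polynomial
  \<open>f (T\<^sub>m \<circ> s) - (f \<circ> s) T\<^sub>m\<close> is nonzero; this eliminates \<open>T\<^sub>m\<close>, and all forms without \<open>x\<^sub>v\<close> stay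
  common factors. The remaining part of each term depends only on the forms touched so far, at most
  \<open>k\<close> per step. After fewer than \<open>k\<close> steps a single term is left, and the touched forms can be given
  arbitrary values by changing as many coordinates as there are such forms. Hence a nonzero \<open>f\<close> does
  not vanish identically on the points that differ from \<open>a\<close> in at most \<open>(k - 1) (k + 1)\<close>
  coordinates. Since \<open>f\<close> has degree at most \<open>k\<close> in each variable, finitely many values of these
  coordinates suffice, and the program tries them all.

  Differences are used instead of derivatives because the characteristic may be positive. To have
  enough room for general position arguments, they are carried out over the infinite field
  of rational functions over the given field.
\<close>

section \<open>Functions that are polynomial in every coordinate\<close>

text \<open>Points are always moved one coordinate at a time, so polynomiality along coordinate
  lines suffices. The polynomial may vary with the base point and has no uniform degree bound, which
  makes the closure properties cheap.\<close>

definition polyfun :: "((nat \<Rightarrow> 'k::field) \<Rightarrow> 'k) \<Rightarrow> bool" where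
  "polyfun f \<longleftrightarrow> (\<forall>x v. \<exists>p. \<forall>t. f (x(v := t)) = poly p t)"

lemma polyfunI: "(\<And>x v. \<exists>p. \<forall>t. f (x(v := t)) = poly p t) \<Longrightarrow> polyfun f"
  by (simp add: polyfun_def)

lemma polyfunD: "polyfun f \<Longrightarrow> \<exists>p. \<forall>t. f (x(v := t)) = poly p t"
  by (simp add: polyfun_def)

lemma polyfun_const: "polyfun (\<lambda>_. c)"
  by (rule polyfunI, rule exI[of _ "[:c:]"]) simp

lemma polyfun_coord: "polyfun (\<lambda>x. x u)"
proof (rule polyfunI)
  fix x :: "nat \<Rightarrow> 'a" and v
  show "\<exists>p. \<forall>t. (x(v := t)) u = poly p t"
    by (rule exI[of _ "if u = v then [:0, 1:] else [:x u:]"]) simp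
qed

lemma polyfun_add:
  assumes "polyfun f" "polyfun g"
  shows "polyfun (\<lambda>x. f x + g x)"
proof (rule polyfunI)
  fix x v
  obtain p where p: "\<And>t. f (x(v := t)) = poly p t"
      using polyfunD[OF assms(1), of x v] by blast
  obtain q where q: "\<And>t. g (x(v := t)) = poly q t"
      using polyfunD[OF assms(2), of x v] by blast
  show "\<exists>p. \<forall>t. f (x(v := t)) + g (x(v := t)) = poly p t"
    by (rule exI[of _ "p + q"]) (simp add: p q)
qed

lemma polyfun_mult:
  assumes "polyfun f" "polyfun g"
  shows "polyfun (\<lambda>x. f x * g x)"
proof (rule polyfunI)
  fix x v
  obtain p where p: "\<And>t. f (x(v := t)) = poly p t"
      using polyfunD[OF assms(1), of x v] by blast
  obtain q where q: "\<And>t. g (x(v := t)) = poly q t"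
      using polyfunD[OF assms(2), of x v] by blast
  show "\<exists>p. \<forall>t. f (x(v := t)) * g (x(v := t)) = poly p t"
    by (rule exI[of _ "p * q"]) (simp add: p q)
qed

lemma polyfun_diff:
  assumes "polyfun f" "polyfun g"
  shows "polyfun (\<lambda>x. f x - g x)"
  using polyfun_add[OF assms(1) polyfun_mult[OF polyfun_const[of "-1"] assms(2)]] by simp

lemma polyfun_sum:
  assumes "\<And>i. i \<in> A \<Longrightarrow> polyfun (f i)"
  shows "polyfun (\<lambda>x. \<Sum>i\<in>A. f i x)"
  using assms by (induction A rule: infinite_finite_induct) (simp_all add: polyfun_const polyfun_add)

lemma polyfun_prod:
  assumes "\<And>i. i \<in> A \<Longrightarrow> polyfun (f i)"
  shows "polyfun (\<lambda>x. \<Prod>i\<in>A. f i x)"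
  using assms by (induction A rule: infinite_finite_induct) (simp_all add: polyfun_const polyfun_mult)

lemma polyfun_shift:
  assumes "polyfun f"
  shows "polyfun (\<lambda>x. f (x(u := x u + h)))"
proof (rule polyfunI)
  fix x :: "nat \<Rightarrow> 'a" and v
  show "\<exists>p. \<forall>t. f ((x(v := t))(u := (x(v := t)) u + h)) = poly p t"
  proof (cases "u = v")
    case True
    obtain p where p: "\<And>t. f (x(v := t)) = poly p t"
      using polyfunD[OF assms, of x v] by blast
    show ?thesis
      by (rule exI[of _ "pcompose p [:h, 1:]"]) (simp add: True p poly_pcompose add.commute)
  next
    case False
    obtain p where p: "\<And>t. f ((x(u := x u + h))(v := t)) = poly p t"
      using polyfunD[OF assms, of "(x(u := x u + h))" v] by blast
    show ?thesis
      by (rule exI[of _ p]) (simp add: False fun_upd_twist flip: p)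
  qed
qed

text \<open>Injectivity makes a change of one coordinate of \<open>x\<close> affect at most one
  coordinate of the reindexed point. This allows several points to be packed into one coordinate
  vector.\<close>

lemma polyfun_reindex:
  assumes "polyfun f" "inj \<sigma>"
  shows "polyfun (\<lambda>x. f (\<lambda>u. x (\<sigma> u)))"
proof (rule polyfunI)
  fix x :: "nat \<Rightarrow> 'a" and v
  show "\<exists>p. \<forall>t. f (\<lambda>u. (x(v := t)) (\<sigma> u)) = poly p t"
  proof (cases "v \<in> range \<sigma>")
    case True
    then obtain w where w: "v = \<sigma> w" by blast
    obtain p where p: "\<And>t. f ((\<lambda>u. x (\<sigma> u))(w := t)) = poly p t"
      using polyfunD[OF assms(1), of "(\<lambda>u. x (\<sigma> u))" w] by blast
    have "(\<lambda>u. (x(v := t)) (\<sigma> u)) = (\<lambda>u. x (\<sigma> u))(w := t)" for t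
      using assms(2) by (auto simp: w inj_eq)
    then show ?thesis using p by metis
  next
    case False
    then have "(\<lambda>u. (x(v := t)) (\<sigma> u)) = (\<lambda>u. x (\<sigma> u))" for t
      by (intro ext) (metis fun_upd_other rangeI)
    then show ?thesis by (intro exI[of _ "[:f (\<lambda>u. x (\<sigma> u)):]"]) simp
  qed
qed

section \<open>Common non-zeros and grids\<close>

text \<open>The two points are made equal one coordinate of \<open>S\<close> at a time: over an
  infinite field the product of the two nonzero univariate restrictions has a non-root, and both
  points receive it as their new coordinate.\<close>

lemma polyfun_common_nonzero2:
  fixes f g :: "(nat \<Rightarrow> 'k::field) \<Rightarrow> 'k"
  assumes inf: "infinite (UNIV :: 'k set)" and S: "finite S" and f: "polyfun f" and g: "polyfun g"
    and "f x \<noteq> 0" "g y \<noteq> 0" "\<And>u. u \<notin> S \<Longrightarrow> x u = y u"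
  shows "\<exists>z. f z \<noteq> 0 \<and> g z \<noteq> 0 \<and> (\<forall>u. u \<notin> S \<longrightarrow> z u = x u)"
  using S assms(5-7)
proof (induction S arbitrary: x y rule: finite_induct)
  case empty
  then have "x = y" by auto
  with empty show ?case by blast
next
  case (insert v S)
  obtain p where p: "\<And>t. f (x(v := t)) = poly p t"
      using polyfunD[OF f, of x v] by blast
  obtain q where q: "\<And>t. g (y(v := t)) = poly q t"
      using polyfunD[OF g, of "y" v] by blast
  have "p \<noteq> 0" using p[of "x v"] insert.prems(1) by auto
  moreover have "q \<noteq> 0" using q[of "y v"] insert.prems(2) by auto
  ultimately have "finite {t. poly (p * q) t = 0}" by (simp add: poly_roots_finite)
  then obtain t where "poly (p * q) t \<noteq> 0" using inf ex_new_if_finite by blast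
  then have "f (x(v := t)) \<noteq> 0" "g (y(v := t)) \<noteq> 0" by (auto simp: p q)
  then have "\<exists>z. f z \<noteq> 0 \<and> g z \<noteq> 0 \<and> (\<forall>u. u \<notin> S \<longrightarrow> z u = (x(v := t)) u)"
    by (rule insert.IH) (use insert.prems(3) in simp)
  then obtain z where z: "f z \<noteq> 0" "g z \<noteq> 0" "\<forall>u. u \<notin> S \<longrightarrow> z u = (x(v := t)) u" by blast
  then have "\<forall>u. u \<notin> insert v S \<longrightarrow> z u = x u" by simp
  with z(1,2) show ?case by blast
qed

text \<open>Induction on \<open>A\<close>, pairing the new function with the product of the earlier
  ones.\<close>

lemma polyfun_common_nonzero:
  fixes F :: "'i \<Rightarrow> (nat \<Rightarrow> 'k::field) \<Rightarrow> 'k"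
  assumes inf: "infinite (UNIV :: 'k set)" and S: "finite S" and "finite A"
    and "\<And>i. i \<in> A \<Longrightarrow> polyfun (F i)"
    and "\<And>i. i \<in> A \<Longrightarrow> \<exists>x. F i x \<noteq> 0 \<and> (\<forall>u. u \<notin> S \<longrightarrow> x u = a u)"
  shows "\<exists>z. (\<forall>i\<in>A. F i z \<noteq> 0) \<and> (\<forall>u. u \<notin> S \<longrightarrow> z u = a u)"
  using assms(3-5)
proof (induction A rule: finite_induct)
  case (insert j A)
  have "\<exists>z. (\<forall>i\<in>A. F i z \<noteq> 0) \<and> (\<forall>u. u \<notin> S \<longrightarrow> z u = a u)"
    by (rule insert.IH) (use insert.prems in simp_all)
  then obtain z where z: "\<forall>i\<in>A. F i z \<noteq> 0" "\<forall>u. u \<notin> S \<longrightarrow> z u = a u" by blast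
  obtain x where x: "F j x \<noteq> 0" "\<forall>u. u \<notin> S \<longrightarrow> x u = a u" using insert.prems(2) by blast
  have "\<exists>w. F j w \<noteq> 0 \<and> (\<Prod>i\<in>A. F i w) \<noteq> 0 \<and> (\<forall>u. u \<notin> S \<longrightarrow> w u = x u)"
  proof (rule polyfun_common_nonzero2[OF inf S])
    show "polyfun (F j)" using insert.prems(1) by simp
    show "polyfun (\<lambda>z. \<Prod>i\<in>A. F i z)" using insert.prems(1) by (intro polyfun_prod) simp
    show "(\<Prod>i\<in>A. F i z) \<noteq> 0" using z(1) insert.hyps(1) by simp
  qed (use x z in simp_all)
  then obtain w where w: "F j w \<noteq> 0" "(\<Prod>i\<in>A. F i w) \<noteq> 0" "\<forall>u. u \<notin> S \<longrightarrow> w u = x u" by blast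
  have "\<forall>i\<in>A. F i w \<noteq> 0" using w(2) insert.hyps(1) by simp
  with w(1,3) x(2) show ?case by (intro exI[of _ w]) simp
qed auto

text \<open>Each coordinate of \<open>S\<close> in turn is moved into \<open>E\<close>: a nonzero
  restriction of degree at most \<open>D\<close> cannot vanish on more than \<open>D\<close>
  elements.\<close>

lemma polyfun_grid_nonzero:
  fixes f :: "(nat \<Rightarrow> 'k::field) \<Rightarrow> 'k"
  assumes S: "finite S" and E: "D < card E"
    and f: "\<And>x v. v \<in> S \<Longrightarrow> \<exists>p. degree p \<le> D \<and> (\<forall>t. f (x(v := t)) = poly p t)"
    and "f x \<noteq> 0"
  shows "\<exists>z. f z \<noteq> 0 \<and> (\<forall>u\<in>S. z u \<in> E) \<and> (\<forall>u. u \<notin> S \<longrightarrow> z u = x u)"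
  using S f assms(4)
proof (induction S arbitrary: x rule: finite_induct)
  case (insert v S)
  obtain p where p: "degree p \<le> D" "\<And>t. f (x(v := t)) = poly p t"
    using insert.prems(1)[OF insertI1] by meson
  have "p \<noteq> 0" using p(2)[of "x v"] insert.prems(2) by auto
  then have "card {t. poly p t = 0} \<le> D" "finite {t. poly p t = 0}"
    using card_poly_roots_bound[of p] p(1) poly_roots_finite[of p] by auto
  then have "\<not> E \<subseteq> {t. poly p t = 0}" using E card_mono[of "{t. poly p t = 0}" E] by linarith
  then obtain t where t: "t \<in> E" "f (x(v := t)) \<noteq> 0" using p(2) by auto
  have "\<exists>z. f z \<noteq> 0 \<and> (\<forall>u\<in>S. z u \<in> E) \<and> (\<forall>u. u \<notin> S \<longrightarrow> z u = (x(v := t)) u)"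
    by (rule insert.IH[OF insert.prems(1)[OF insertI2] t(2)])
  then obtain z where "f z \<noteq> 0" "\<forall>u\<in>S. z u \<in> E" "\<forall>u. u \<notin> S \<longrightarrow> z u = (x(v := t)) u"
    by blast
  moreover have "z v \<in> E" using calculation(3) insert.hyps(2) t(1) by simp
  moreover have "\<forall>u. u \<notin> insert v S \<longrightarrow> z u = x u" using calculation(3) by simp
  ultimately show ?case by blast
qed auto

section \<open>Eliminating a term\<close>

definition lin :: "nat \<Rightarrow> (nat \<Rightarrow> 'k::comm_ring_1) \<Rightarrow> (nat \<Rightarrow> 'k) \<Rightarrow> 'k" where
  "lin n c x = (\<Sum>v<n. c v * x v)"

lemma polyfun_lin: "polyfun (lin n c)"
  unfolding lin_def by (intro polyfun_sum polyfun_mult polyfun_const polyfun_coord)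

lemma lin_upd: "v < n \<Longrightarrow> lin n c (x(v := t)) = lin n c x + c v * (t - x v)"
  unfolding lin_def
  by (subst (1 2) sum.remove[of _ v]) (auto simp: algebra_simps intro!: sum.cong)

lemma lin_cong: "(\<And>v. v < n \<Longrightarrow> x v = y v) \<Longrightarrow> lin n c x = lin n c y"
  by (simp add: lin_def)

lemma lin_add: "lin n c (\<lambda>v. x v + y v) = lin n c x + lin n c y"
  by (simp add: lin_def algebra_simps sum.distrib)

lemma lin_diff: "lin n c (\<lambda>v. x v - y v) = lin n c x - lin n c y"
  by (simp add: lin_def algebra_simps sum_subtractf)

lemma lin_scale: "lin n c (\<lambda>v. t * x v) = t * lin n c x"
  by (simp add: lin_def algebra_simps sum_distrib_left)

lemma lin_sum: "lin n c (\<lambda>v. \<Sum>u\<in>A. f u v) = (\<Sum>u\<in>A. lin n c (f u))"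
  unfolding lin_def by (subst sum.swap) (simp add: sum_distrib_left)

text \<open>Column rank is at most row rank.\<close>

lemma lin_coordinate_basis:
  fixes R :: "(nat \<Rightarrow> 'k::field) set"
  assumes "finite R"
  shows "\<exists>S \<subseteq> {..<n}. card S \<le> card R \<and>
    (\<forall>x. \<exists>y. (\<forall>u. u \<notin> S \<longrightarrow> y u = 0) \<and> (\<forall>c\<in>R. lin n c y = lin n c x))"
  using assms
proof (induction R rule: finite_induct)
  case empty
  show ?case by (intro exI[of _ "{}"]) auto
next
  case (insert c R)
  then obtain S where S: "S \<subseteq> {..<n}" "card S \<le> card R"
    and ex: "\<forall>x. \<exists>y. (\<forall>u. u \<notin> S \<longrightarrow> y u = 0) \<and> (\<forall>c\<in>R. lin n c y = lin n c x)" by blast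
  from choice[OF ex] obtain g where g0: "\<And>x u. u \<notin> S \<Longrightarrow> g x u = 0"
    and g: "\<And>x c. c \<in> R \<Longrightarrow> lin n c (g x) = lin n c x" by auto
  have finS: "finite S" using S(1) finite_subset by blast
  \<comment> \<open>\<open>b u\<close> is a unit vector. The map \<open>g\<close> picks
    representatives supported on \<open>S\<close>, but need not be linear.\<close>
  define b :: "nat \<Rightarrow> nat \<Rightarrow> 'k" where "b u = (\<lambda>_. 0)(u := 1)" for u
  have b: "lin n c' b' = c' u" if "u < n" "b' = b u" for c' u b'
    using lin_upd[of u n c' "\<lambda>_. 0" 1] that by (simp add: b_def lin_def)
  show ?case
  proof (cases "\<exists>u<n. lin n c (g (b u)) \<noteq> lin n c (b u)")
    case True
    then obtain u where u: "u < n" "lin n c (g (b u)) \<noteq> lin n c (b u)" by blast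
    \<comment> \<open>All functionals in \<open>R\<close> vanish on \<open>z\<close> while
      \<open>c\<close> does not, so adding a multiple of \<open>z\<close> corrects the value of
      \<open>c\<close> alone, at the price of the single extra coordinate \<open>u\<close>.\<close>
    define z where "z = (\<lambda>w. b u w - g (b u) w)"
    have zR: "lin n c' z = 0" if "c' \<in> R" for c' using that by (simp add: z_def lin_diff g)
    have zc: "lin n c z \<noteq> 0" using u(2) by (simp add: z_def lin_diff)
    have "\<exists>y. (\<forall>w. w \<notin> insert u S \<longrightarrow> y w = 0) \<and> (\<forall>c\<in>insert c R. lin n c y = lin n c x)" for x
    proof -
      define t where "t = (lin n c x - lin n c (g x)) / lin n c z"
      have t: "t * lin n c z = lin n c x - lin n c (g x)" using zc by (simp add: t_def)
      show ?thesis
        by (rule exI[of _ "\<lambda>w. g x w + t * z w"])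
          (auto simp: lin_add lin_scale t g zR, simp add: z_def g0 b_def)
    qed
    moreover have "card (insert u S) \<le> card (insert c R)"
      using S(2) insert.hyps finS by (simp add: card_insert_if)
    ultimately show ?thesis using S(1) u(1) by (intro exI[of _ "insert u S"]) auto
  next
    case False
    \<comment> \<open>Here \<open>c\<close> too has the right value on every representative of a
      unit vector. The linear extension of these representatives therefore serves all of
      \<open>insert c R\<close>, and \<open>S\<close> need not grow.\<close>
    have "\<exists>y. (\<forall>w. w \<notin> S \<longrightarrow> y w = 0) \<and> (\<forall>c\<in>insert c R. lin n c y = lin n c x)" for x
    proof -
      have "lin n c' (\<lambda>w. \<Sum>u<n. x u * g (b u) w) = lin n c' x"
        if "\<And>u. u < n \<Longrightarrow> lin n c' (g (b u)) = lin n c' (b u)" for c'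
      proof -
        have "lin n c' (\<lambda>w. \<Sum>u<n. x u * g (b u) w) = (\<Sum>u<n. x u * c' u)"
          by (simp add: lin_sum lin_scale that b)
        then show ?thesis by (simp add: lin_def mult.commute)
      qed
      then show ?thesis using False g
        by (intro exI[of _ "\<lambda>w. \<Sum>u<n. x u * g (b u) w"]) (auto simp: g0)
    qed
    moreover have "card S \<le> card (insert c R)" using S(2) insert.hyps by simp
    ultimately show ?thesis using S(1) by (intro exI[of _ S]) auto
  qed
qed

text \<open>
  At a generic pair \<open>x\<close>, \<open>y\<close> the function \<open>g\<close> vanishes nowhere on the path that changes \<open>y\<close> into
  \<open>x\<close> one coordinate at a time, so \<open>f / g\<close> must change along one of its steps.
\<close>

lemma nonproportional_step:
  fixes f g :: "(nat \<Rightarrow> 'k::field) \<Rightarrow> 'k"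
  assumes inf: "infinite (UNIV :: 'k set)" and f: "polyfun f" and g: "polyfun g"
    and locf: "\<And>x y. (\<And>v. v < n \<Longrightarrow> x v = y v) \<Longrightarrow> f x = f y"
    and locg: "\<And>x y. (\<And>v. v < n \<Longrightarrow> x v = y v) \<Longrightarrow> g x = g y"
    and g0: "g w \<noteq> 0" and fg: "f x * g y \<noteq> f y * g x"
  shows "\<exists>x v h. v < n \<and> f x * g (x(v := x v + h)) \<noteq> f (x(v := x v + h)) * g x"
proof -
  \<comment> \<open>One vector interleaves two points, at even and at odd positions. Reading it
    through \<open>\<sigma> i\<close> takes the first \<open>i\<close> coordinates from the even
    point and the rest from the odd one.\<close>
  define \<sigma> where "\<sigma> i u = (if u < i then 2 * u else 2 * u + 1)" for i u :: nat
  have inj: "inj (\<sigma> i)" for i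
    by (rule injI) (auto simp: \<sigma>_def split: if_splits; presburger)
  \<comment> \<open>\<open>F 0\<close> being nonzero says that \<open>f / g\<close> differs at the
    two ends of the path; \<open>F (Suc i)\<close> is \<open>g\<close> at the \<open>i\<close>-th
    intermediate point. A common non-zero is the generic pair.\<close>
  define F where "F i = (case i of 0 \<Rightarrow> (\<lambda>z. f (\<lambda>u. z (\<sigma> n u)) * g (\<lambda>u. z (\<sigma> 0 u)) - f (\<lambda>u. z (\<sigma> 0 u)) * g (\<lambda>u. z (\<sigma> n u)))
     | Suc i \<Rightarrow> (\<lambda>z. g (\<lambda>u. z (\<sigma> i u))))" for i
  have pF: "polyfun (F i)" for i
    using polyfun_reindex[OF f inj] polyfun_reindex[OF g inj]
    by (cases i) (auto simp: F_def intro!: polyfun_diff polyfun_mult)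
  have nF: "\<exists>z. F i z \<noteq> 0 \<and> (\<forall>u. u \<notin> {..<2 * n} \<longrightarrow> z u = 0)" for i
  proof (cases i)
    case 0
    define z where "z = (\<lambda>u. if u < 2 * n then if even u then x (u div 2) else y (u div 2) else 0)"
    have "f (\<lambda>u. z (\<sigma> n u)) = f x" "g (\<lambda>u. z (\<sigma> n u)) = g x"
      "f (\<lambda>u. z (\<sigma> 0 u)) = f y" "g (\<lambda>u. z (\<sigma> 0 u)) = g y"
      by (rule locf locg; simp add: z_def \<sigma>_def)+
    then show ?thesis using fg by (intro exI[of _ z]) (simp add: F_def 0 z_def)
  next
    case (Suc i)
    define z where "z = (\<lambda>u. if u < 2 * n then w (u div 2) else 0)"
    have "g (\<lambda>u. z (\<sigma> i u)) = g w"
      by (rule locg) (simp add: z_def \<sigma>_def)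
    then show ?thesis using g0 by (intro exI[of _ z]) (simp add: F_def Suc z_def)
  qed
  obtain z where z: "\<forall>i\<in>{..Suc n}. F i z \<noteq> 0"
    using polyfun_common_nonzero[OF inf, of "{..<2 * n}" "{..Suc n}" F "\<lambda>_. 0"] pF nF by auto
  define m where "m i = (\<lambda>u. z (\<sigma> i u))" for i
  have gm: "g (m i) \<noteq> 0" if "i \<le> n" for i
    using z[rule_format, of "Suc i"] that by (simp add: F_def m_def)
  have "f (m n) * g (m 0) \<noteq> f (m 0) * g (m n)"
    using z[rule_format, of 0] by (simp add: F_def m_def)
  then have ne: "f (m n) / g (m n) \<noteq> f (m 0) / g (m 0)" using gm by (simp add: field_simps)
  have "\<exists>i<n. f (m (Suc i)) / g (m (Suc i)) \<noteq> f (m i) / g (m i)"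
  proof (rule ccontr)
    assume "\<not> ?thesis"
    then have "i \<le> n \<Longrightarrow> f (m i) / g (m i) = f (m 0) / g (m 0)" for i
      by (induction i) auto
    with ne show False by blast
  qed
  then obtain i where i: "i < n" "f (m (Suc i)) / g (m (Suc i)) \<noteq> f (m i) / g (m i)" by blast
  \<comment> \<open>Consecutive points of the path differ only in coordinate \<open>i\<close>, where
    the odd entry gives way to the even one.\<close>
  have "m (Suc i) = (m i)(i := m i i + (m (Suc i) i - m i i))"
    by (auto simp: m_def \<sigma>_def fun_eq_iff)
  moreover have "f (m i) * g (m (Suc i)) \<noteq> f (m (Suc i)) * g (m i)"
    using i gm[of i] gm[of "Suc i"] by (simp add: field_simps)
  ultimately show ?thesis using i(1) by metis
qed

text \<open>
  \<open>Q i\<close> is the part of term \<open>i\<close> affected by earlier eliminations. It may vanish at \<open>a\<close>, but it only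
  depends on the linear forms in \<open>R\<close>.
\<close>

lemma small_support_nonzero:
  fixes a :: "nat \<Rightarrow> 'k::field" and C :: "'i \<Rightarrow> 'j \<Rightarrow> nat \<Rightarrow> 'k" and b :: "'i \<Rightarrow> 'j \<Rightarrow> 'k"
  assumes inf: "infinite (UNIV :: 'k set)"
    and "finite I" "card I = m" "\<And>i. i \<in> I \<Longrightarrow> finite (J i)"
    and "\<And>i j. i \<in> I \<Longrightarrow> j \<in> J i \<Longrightarrow> b i j + lin n (C i j) a \<noteq> 0"
    and "\<And>v. v < n \<Longrightarrow> card {(i, j). i \<in> I \<and> j \<in> J i \<and> C i j v \<noteq> 0} \<le> k"
    and "finite R" "\<And>i. i \<in> I \<Longrightarrow> polyfun (Q i)"
    and "\<And>i x y. i \<in> I \<Longrightarrow> (\<And>c. c \<in> R \<Longrightarrow> lin n c x = lin n c y) \<Longrightarrow> Q i x = Q i y"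
    and "(\<Sum>i\<in>I. (\<Prod>j\<in>J i. b i j + lin n (C i j) x) * Q i x) \<noteq> 0"
  shows "\<exists>S \<subseteq> {..<n}. card S + (k + 1) \<le> card R + m * (k + 1) \<and>
    (\<exists>y. (\<forall>u. u \<notin> S \<longrightarrow> y u = a u) \<and> (\<Sum>i\<in>I. (\<Prod>j\<in>J i. b i j + lin n (C i j) y) * Q i y) \<noteq> 0)"
  using assms(2-)
\<comment> \<open>An elimination adds one coordinate to \<open>S\<close> and at most
  \<open>k\<close> forms to \<open>R\<close>; losing a term pays \<open>k + 1\<close> for that. The
  last remaining term costs only \<open>card R\<close>, which explains the \<open>k + 1\<close> on
  the left.\<close>
proof (induction m arbitrary: I J Q R x)
  case 0
  then have "I = {}" by (metis card_0_eq)
  with 0(9) show ?case by simp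
next
  case (Suc m)
  note finI = Suc.prems(1) and cardI = Suc.prems(2) and finJ = Suc.prems(3) and nz = Suc.prems(4)
    and rd = Suc.prems(5) and finR = Suc.prems(6) and polQ = Suc.prems(7) and QR = Suc.prems(8)
  define \<phi> where "\<phi> i j z = b i j + lin n (C i j) z" for i j z
  define T where "T i z = (\<Prod>j\<in>J i. \<phi> i j z) * Q i z" for i z
  define f where "f z = (\<Sum>i\<in>I. T i z)" for z
  have pol\<phi>: "polyfun (\<phi> i j)" for i j
    using polyfun_add[OF polyfun_const[of "b i j"] polyfun_lin[of n "C i j"]] by (simp add: \<phi>_def[abs_def])
  have polprod: "polyfun (\<lambda>z. \<Prod>j\<in>A. \<phi> i j z)" for i A
    by (rule polyfun_prod[OF pol\<phi>])
  have polT: "polyfun (T i)" if "i \<in> I" for i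
    using polyfun_mult[OF polprod polQ[OF that]] by (simp add: T_def[abs_def])
  have polf: "polyfun f" using polyfun_sum[of I T, OF polT] by (simp add: f_def[abs_def])
  have loc\<phi>: "\<phi> i j y = \<phi> i j z" if "\<And>v. v < n \<Longrightarrow> y v = z v" for i j y z
    using lin_cong[of n y z, OF that] by (simp add: \<phi>_def)
  have locT: "T i y = T i z" if "i \<in> I" "\<And>v. v < n \<Longrightarrow> y v = z v" for i y z
    using loc\<phi>[OF that(2)] QR[OF that(1) lin_cong[OF that(2)]] by (simp add: T_def)
  have locf: "f y = f z" if "\<And>v. v < n \<Longrightarrow> y v = z v" for y z
    unfolding f_def by (intro sum.cong refl locT that)
  have fx: "f x \<noteq> 0" using Suc.prems(9) by (simp add: f_def T_def \<phi>_def)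
  then obtain j where j: "j \<in> I" "T j x \<noteq> 0" unfolding f_def by (meson sum.neutral)
  have goal: ?case if "S \<subseteq> {..<n}" "card S + (k + 1) \<le> card R + Suc m * (k + 1)"
    "\<forall>u. u \<notin> S \<longrightarrow> y u = a u" "f y \<noteq> 0" for S y
    using that unfolding f_def T_def \<phi>_def by blast
  show ?case
  \<comment> \<open>In the first case \<open>f\<close> is proportional to \<open>T j\<close>, so a
    non-zero of this single term near \<open>a\<close> is enough.\<close>
  proof (cases "\<forall>y z. f y * T j z = f z * T j y")
    case True
    obtain S where S: "S \<subseteq> {..<n}" "card S \<le> card R"
      and ex: "\<forall>x. \<exists>y. (\<forall>u. u \<notin> S \<longrightarrow> y u = 0) \<and> (\<forall>c\<in>R. lin n c y = lin n c x)"
      using lin_coordinate_basis[OF finR, of n] by blast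
    \<comment> \<open>Moving \<open>a\<close> by \<open>w\<close> gives the forms in
      \<open>R\<close> their values at \<open>x\<close>, hence makes \<open>Q j\<close> nonzero. The
      other factors of \<open>T j\<close> are nonzero at \<open>a\<close> itself, and a common
      non-zero of both exists on the same coordinates.\<close>
    obtain w where w: "\<forall>u. u \<notin> S \<longrightarrow> w u = 0" "\<forall>c\<in>R. lin n c w = lin n c (\<lambda>v. x v - a v)"
      using ex by blast
    define y where "y v = a v + w v" for v
    have "lin n c y = lin n c x" if "c \<in> R" for c
      using w(2) that lin_add[of n c a w] by (simp add: y_def[abs_def] lin_diff)
    then have "Q j y = Q j x" by (rule QR[OF j(1)])
    then have Qy: "Q j y \<noteq> 0" using j(2) by (auto simp: T_def)
    have "(\<Prod>l\<in>J j. \<phi> j l a) \<noteq> 0" using nz[OF j(1)] finJ[OF j(1)] by (simp add: \<phi>_def)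
    moreover have "finite S" using S(1) finite_subset by blast
    ultimately have "\<exists>z. (\<Prod>l\<in>J j. \<phi> j l z) \<noteq> 0 \<and> Q j z \<noteq> 0 \<and> (\<forall>u. u \<notin> S \<longrightarrow> z u = a u)"
      by (intro polyfun_common_nonzero2[OF inf _ polprod polQ[OF j(1)] _ Qy])
        (use w(1) in \<open>simp_all add: y_def\<close>)
    then obtain z where z: "T j z \<noteq> 0" "\<forall>u. u \<notin> S \<longrightarrow> z u = a u" unfolding T_def by auto
    have "f x * T j z = f z * T j x" using True by blast
    then have "f z \<noteq> 0" using fx z(1) by auto
    with S z(2) show ?thesis by (intro goal) auto
  next
    case False
    then obtain y0 z0 where "f y0 * T j z0 \<noteq> f z0 * T j y0" by blast
    then have "\<exists>x v h. v < n \<and> f x * T j (x(v := x v + h)) \<noteq> f (x(v := x v + h)) * T j x"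
      by (intro nonproportional_step[OF inf polf polT[OF j(1)] locf locT[OF j(1)] j(2)])
    then obtain x' v h where v: "v < n"
      and ne: "f x' * T j (x'(v := x' v + h)) \<noteq> f (x'(v := x' v + h)) * T j x'" by blast
    \<comment> \<open>Forms without the variable \<open>v\<close> are invariant under the shift.
      They are collected in \<open>G\<close>; the forms containing \<open>v\<close> go to
      \<open>A\<close>.\<close>
    define s where "s z = z(v := z v + h)" for z :: "nat \<Rightarrow> 'k"
    define J' where "J' i = {l \<in> J i. C i l v = 0}" for i
    define A where "A i z = (\<Prod>l\<in>J i - J' i. \<phi> i l z)" for i z
    define G where "G i z = (\<Prod>l\<in>J' i. \<phi> i l z)" for i z
    \<comment> \<open>In the cross difference of term \<open>i\<close> with term \<open>j\<close>
      the invariant factors \<open>G i\<close> and \<open>G j\<close> split off, and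
      \<open>Q' i\<close> is what remains. It vanishes identically for \<open>i = j\<close>, which
      removes that term.\<close>
    define Q' where "Q' i z = A i z * Q i z * (A j (s z) * Q j (s z)) - A i (s z) * Q i (s z) * (A j z * Q j z)" for i z
    define g where "g z = (\<Sum>i\<in>I - {j}. G i z * Q' i z)" for z
    have lins: "lin n c (s z) = lin n c z + c v * h" for c z
      using lin_upd[OF v, of c z] by (simp add: s_def)
    have \<phi>s: "\<phi> i l (s z) = \<phi> i l z" if "l \<in> J' i" for i l z
      using that by (simp add: J'_def \<phi>_def lins)
    have Gs: "G i (s z) = G i z" for i z unfolding G_def by (intro prod.cong refl \<phi>s)
    have T: "T i z = G i z * A i z * Q i z" if "i \<in> I" for i z
      using prod.subset_diff[of "J' i" "J i" "\<lambda>l. \<phi> i l z"] finJ[OF that]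
      by (auto simp: T_def G_def A_def J'_def)
    have fg: "f z * T j (s z) - f (s z) * T j z = G j z * g z" for z
    proof -
      have "f z * T j (s z) - f (s z) * T j z = (\<Sum>i\<in>I. T i z * T j (s z) - T i (s z) * T j z)"
        by (simp add: f_def sum_distrib_right sum_subtractf)
      also have "\<dots> = (\<Sum>i\<in>I - {j}. T i z * T j (s z) - T i (s z) * T j z)"
        by (subst sum.remove[OF finI j(1)]) simp
      also have "\<dots> = (\<Sum>i\<in>I - {j}. G j z * (G i z * Q' i z))"
        by (intro sum.cong refl) (simp add: T j(1) Gs Q'_def algebra_simps)
      finally show ?thesis by (simp add: g_def sum_distrib_left)
    qed
    define touched where "touched = {(i, l). i \<in> I \<and> l \<in> J i \<and> C i l v \<noteq> 0}"
    have "finite (SIGMA i:I. J i)" using finI finJ by blast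
    then have fint: "finite touched" by (rule finite_subset[rotated]) (auto simp: touched_def)
    \<comment> \<open>By \<open>lins\<close>, the value of a form at \<open>z\<close> determines its
      value at \<open>s z\<close>. Adding the touched forms therefore suffices to determine every
      \<open>Q' i\<close>.\<close>
    define R' where "R' = R \<union> (\<lambda>(i, l). C i l) ` touched"
    have "card R' \<le> card R + card ((\<lambda>(i, l). C i l) ` touched)"
      unfolding R'_def by (rule card_Un_le)
    also have "\<dots> \<le> card R + k"
      using card_image_le[OF fint, of "\<lambda>(i, l). C i l"] rd[OF v] by (simp add: touched_def)
    finally have cardR': "card R' \<le> card R + k" .
    have polA: "polyfun (A i)" for i using polprod by (simp add: A_def[abs_def])
    have polG: "polyfun (G i)" for i using polprod by (simp add: G_def[abs_def])
    have pols: "polyfun (\<lambda>z. F (s z))" if "polyfun F" for F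
      using polyfun_shift[OF that] by (simp add: s_def)
    have polQ': "polyfun (Q' i)" if "i \<in> I" for i
      unfolding Q'_def[abs_def] by (intro polyfun_diff polyfun_mult pols polA polQ that j(1))
    have "\<exists>S \<subseteq> {..<n}. card S + (k + 1) \<le> card R' + m * (k + 1) \<and>
      (\<exists>y. (\<forall>u. u \<notin> S \<longrightarrow> y u = a u) \<and>
        (\<Sum>i\<in>I - {j}. (\<Prod>l\<in>J' i. b i l + lin n (C i l) y) * Q' i y) \<noteq> 0)"
    proof (rule Suc.IH)
      show "finite (I - {j})" "card (I - {j}) = m" using finI cardI j(1) by simp_all
      show "finite (J' i)" if "i \<in> I - {j}" for i using finJ that by (simp add: J'_def)
      show "b i l + lin n (C i l) a \<noteq> 0" if "i \<in> I - {j}" "l \<in> J' i" for i l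
        using nz that by (simp add: J'_def)
      show "card {(i, l). i \<in> I - {j} \<and> l \<in> J' i \<and> C i l u \<noteq> 0} \<le> k" if "u < n" for u
      proof (rule order_trans[OF card_mono rd[OF that]])
        show "finite {(i, l). i \<in> I \<and> l \<in> J i \<and> C i l u \<noteq> 0}"
          by (rule finite_subset[OF _ \<open>finite (SIGMA i:I. J i)\<close>]) auto
      qed (auto simp: J'_def)
      show "finite R'" using finR fint by (simp add: R'_def)
      show "polyfun (Q' i)" if "i \<in> I - {j}" for i using polQ' that by blast
      show "Q' i y = Q' i z" if i: "i \<in> I - {j}" and "\<And>c. c \<in> R' \<Longrightarrow> lin n c y = lin n c z" for i y z
      proof -
        have eq: "\<phi> i l y = \<phi> i l z \<and> \<phi> i l (s y) = \<phi> i l (s z)" if "i \<in> I" "l \<in> J i - J' i" for i l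
        proof -
          have "(i, l) \<in> touched" using that by (simp add: touched_def J'_def)
          then have "C i l \<in> R'" by (force simp: R'_def)
          then show ?thesis using \<open>\<And>c. c \<in> R' \<Longrightarrow> lin n c y = lin n c z\<close> by (simp add: \<phi>_def lins)
        qed
        have A: "A i y = A i z" "A i (s y) = A i (s z)" if "i \<in> I" for i
          unfolding A_def using eq[OF that] by (auto intro!: prod.cong)
        have Q: "Q i y = Q i z" "Q i (s y) = Q i (s z)" if "i \<in> I" for i
          using \<open>\<And>c. c \<in> R' \<Longrightarrow> lin n c y = lin n c z\<close>
          by (auto intro!: QR[OF that] simp: lins R'_def)
        show ?thesis using A Q i j(1) by (simp add: Q'_def)
      qed
      have "G j x' * g x' \<noteq> 0" using ne unfolding fg[of x', symmetric] by (simp add: s_def)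
      then show "(\<Sum>i\<in>I - {j}. (\<Prod>l\<in>J' i. b i l + lin n (C i l) x') * Q' i x') \<noteq> 0"
        by (simp add: g_def G_def \<phi>_def)
    qed
    then obtain S y where S: "S \<subseteq> {..<n}" "card S + (k + 1) \<le> card R' + m * (k + 1)"
      and y: "\<forall>u. u \<notin> S \<longrightarrow> y u = a u" "g y \<noteq> 0"
      unfolding g_def G_def \<phi>_def by blast
    have finS: "finite S" using S(1) finite_subset by blast
    have polg: "polyfun g" unfolding g_def[abs_def]
      by (intro polyfun_sum polyfun_mult polG polQ') blast
    \<comment> \<open>The factor \<open>G j\<close> contains only original forms, none of which
      vanishes at \<open>a\<close>, so it can be kept nonzero together with \<open>g\<close> without
      enlarging \<open>S\<close>.\<close>
    have "G j a \<noteq> 0" using nz[OF j(1)] finJ[OF j(1)] by (simp add: G_def J'_def \<phi>_def)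
    then have "\<exists>z. G j z \<noteq> 0 \<and> g z \<noteq> 0 \<and> (\<forall>u. u \<notin> S \<longrightarrow> z u = a u)"
      by (rule polyfun_common_nonzero2[OF inf finS polG polg _ y(2)]) (use y(1) in simp)
    then obtain z where z: "G j z * g z \<noteq> 0" "\<forall>u. u \<notin> S \<longrightarrow> z u = a u" by auto
    \<comment> \<open>By \<open>fg\<close>, \<open>f\<close> cannot vanish at both \<open>z\<close>
      and \<open>s z\<close>. The shifted point differs from \<open>a\<close> in at most the
      additional coordinate \<open>v\<close>.\<close>
    define w where "w = (if f z \<noteq> 0 then z else s z)"
    have "f w \<noteq> 0" using z(1) fg[of z] by (auto simp: w_def)
    moreover have "\<forall>u. u \<notin> insert v S \<longrightarrow> w u = a u" using z(2) by (simp add: w_def s_def)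
    moreover have "card (insert v S) + (k + 1) \<le> card R + Suc m * (k + 1)"
      using S(2) cardR' finS by (simp add: card_insert_if)
    moreover have "insert v S \<subseteq> {..<n}" using S(1) v by simp
    ultimately show ?thesis by (intro goal)
  qed
qed

section \<open>Evaluation of polynomials\<close>

definition mon_eval :: "(nat \<Rightarrow>\<^sub>0 nat) \<Rightarrow> (nat \<Rightarrow> 'b::comm_semiring_1) \<Rightarrow> 'b" where
  "mon_eval m x = (\<Prod>v\<in>Poly_Mapping.keys m. x v ^ Poly_Mapping.lookup m v)"

lemma mon_eval_superset:
  assumes "finite A" "Poly_Mapping.keys m \<subseteq> A"
  shows "mon_eval m x = (\<Prod>v\<in>A. x v ^ Poly_Mapping.lookup m v)"
  unfolding mon_eval_def using assms by (intro prod.mono_neutral_left) (auto simp: in_keys_iff)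

lemma mon_eval_0 [simp]: "mon_eval 0 x = 1"
  by (simp add: mon_eval_def)

lemma mon_eval_add: "mon_eval (m + m') x = mon_eval m x * mon_eval m' x"
proof -
  let ?A = "Poly_Mapping.keys m \<union> Poly_Mapping.keys m'"
  have "mon_eval (m + m') x = (\<Prod>v\<in>?A. x v ^ Poly_Mapping.lookup (m + m') v)"
    by (rule mon_eval_superset) (simp_all add: keys_add)
  also have "\<dots> = (\<Prod>v\<in>?A. x v ^ Poly_Mapping.lookup m v) * (\<Prod>v\<in>?A. x v ^ Poly_Mapping.lookup m' v)"
    by (simp add: lookup_add power_add prod.distrib)
  finally show ?thesis
    using mon_eval_superset[of ?A m x] mon_eval_superset[of ?A m' x] by simp
qed

lemma field_embedding_zero: "field_embedding \<iota> \<Longrightarrow> \<iota> 0 = 0"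
  unfolding field_embedding_def by (metis add_cancel_right_left)

lemma field_embedding_add: "field_embedding \<iota> \<Longrightarrow> \<iota> (x + y) = \<iota> x + \<iota> y"
  by (simp add: field_embedding_def)

lemma field_embedding_mult: "field_embedding \<iota> \<Longrightarrow> \<iota> (x * y) = \<iota> x * \<iota> y"
  by (simp add: field_embedding_def)

lemma field_embedding_eq_0_iff:
  assumes "field_embedding \<iota>"
  shows "\<iota> c = 0 \<longleftrightarrow> c = 0"
proof
  assume "\<iota> c = 0"
  moreover have "\<iota> (c * inverse c) = \<iota> c * \<iota> (inverse c)" "\<iota> 1 = 1"
    using assms by (simp_all add: field_embedding_def)
  ultimately show "c = 0" by (cases "c = 0") simp_all
qed (use assms field_embedding_zero in simp)

lemma field_embedding_inj:
  assumes "field_embedding \<iota>"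
  shows "inj \<iota>"
proof (rule injI)
  fix x y assume "\<iota> x = \<iota> y"
  moreover have "\<iota> ((x - y) + y) = \<iota> (x - y) + \<iota> y" using assms unfolding field_embedding_def by blast
  ultimately have "\<iota> (x - y) = 0" by simp
  then show "x = y" using field_embedding_eq_0_iff[OF assms] by simp
qed

lemma field_embedding_sum:
  "field_embedding \<iota> \<Longrightarrow> \<iota> (\<Sum>i\<in>A. f i) = (\<Sum>i\<in>A. \<iota> (f i))"
  by (induction A rule: infinite_finite_induct) (simp_all add: field_embedding_zero field_embedding_def)

lemma field_embedding_prod:
  "field_embedding \<iota> \<Longrightarrow> \<iota> (\<Prod>i\<in>A. f i) = (\<Prod>i\<in>A. \<iota> (f i))"
  by (induction A rule: infinite_finite_induct) (simp_all add: field_embedding_def)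

lemma field_embedding_power: "field_embedding \<iota> \<Longrightarrow> \<iota> (c ^ m) = \<iota> c ^ m"
  by (induction m) (simp_all add: field_embedding_def)

lemma field_embedding_comp:
  "field_embedding \<iota> \<Longrightarrow> field_embedding \<kappa> \<Longrightarrow> field_embedding (\<lambda>c. \<kappa> (\<iota> c))"
  by (simp add: field_embedding_def)

lemma meval_superset:
  assumes "field_embedding \<iota>" "finite A" "Poly_Mapping.keys p \<subseteq> A"
  shows "meval \<iota> p x = (\<Sum>m\<in>A. \<iota> (Poly_Mapping.lookup p m) * mon_eval m x)"
  unfolding meval_def mon_eval_def[symmetric] using assms
  by (intro sum.mono_neutral_left) (auto simp: in_keys_iff field_embedding_zero)

lemma meval_zero [simp]: "meval \<iota> 0 x = 0"
  by (simp add: meval_def)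

lemma meval_add:
  assumes "field_embedding \<iota>"
  shows "meval \<iota> (p + q) x = meval \<iota> p x + meval \<iota> q x"
proof -
  let ?A = "Poly_Mapping.keys p \<union> Poly_Mapping.keys q"
  have "meval \<iota> (p + q) x = (\<Sum>m\<in>?A. \<iota> (Poly_Mapping.lookup (p + q) m) * mon_eval m x)"
    by (rule meval_superset[OF assms]) (simp_all add: keys_add)
  also have "\<dots> = (\<Sum>m\<in>?A. \<iota> (Poly_Mapping.lookup p m) * mon_eval m x)
      + (\<Sum>m\<in>?A. \<iota> (Poly_Mapping.lookup q m) * mon_eval m x)"
    using assms by (simp add: lookup_add field_embedding_def distrib_right sum.distrib)
  finally show ?thesis
    using meval_superset[OF assms, of ?A p x] meval_superset[OF assms, of ?A q x] by simp
qed

lemma meval_sum: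
  "field_embedding \<iota> \<Longrightarrow> meval \<iota> (\<Sum>i\<in>A. p i) x = (\<Sum>i\<in>A. meval \<iota> (p i) x)"
  by (induction A rule: infinite_finite_induct) (simp_all add: meval_add)

lemma meval_single:
  assumes "field_embedding \<iota>"
  shows "meval \<iota> (Poly_Mapping.single m c) x = \<iota> c * mon_eval m x"
  using meval_superset[OF assms, of "{m}" "Poly_Mapping.single m c" x] by simp

lemma poly_mapping_eq_sum_single:
  "(p :: 'm \<Rightarrow>\<^sub>0 'c::comm_monoid_add) = (\<Sum>m\<in>Poly_Mapping.keys p. Poly_Mapping.single m (Poly_Mapping.lookup p m))"
  by (rule poly_mapping_eqI) (auto simp: lookup_sum lookup_single when_def in_keys_iff sum.delta)

lemma meval_mult:
  assumes "field_embedding \<iota>"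
  shows "meval \<iota> (p * q) x = meval \<iota> p x * meval \<iota> q x"
proof -
  let ?s = "Poly_Mapping.single"
  have "p * q = (\<Sum>m\<in>Poly_Mapping.keys p. ?s m (Poly_Mapping.lookup p m))
      * (\<Sum>m\<in>Poly_Mapping.keys q. ?s m (Poly_Mapping.lookup q m))"
    using poly_mapping_eq_sum_single[of p] poly_mapping_eq_sum_single[of q] by simp
  also have "\<dots> = (\<Sum>m\<in>Poly_Mapping.keys p. \<Sum>m'\<in>Poly_Mapping.keys q.
      ?s (m + m') (Poly_Mapping.lookup p m * Poly_Mapping.lookup q m'))"
    by (simp add: sum_product mult_single)
  finally have "meval \<iota> (p * q) x = (\<Sum>m\<in>Poly_Mapping.keys p. \<Sum>m'\<in>Poly_Mapping.keys q.
      \<iota> (Poly_Mapping.lookup p m) * mon_eval m x * (\<iota> (Poly_Mapping.lookup q m') * mon_eval m' x))"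
    using assms by (simp add: meval_sum meval_single mon_eval_add field_embedding_def algebra_simps)
  then show ?thesis by (simp add: meval_def mon_eval_def sum_product)
qed

lemma meval_one: "field_embedding \<iota> \<Longrightarrow> meval \<iota> 1 x = 1"
  using meval_single[of \<iota> 0 1 x] by (simp add: field_embedding_def)

lemma meval_prod:
  "field_embedding \<iota> \<Longrightarrow> meval \<iota> (\<Prod>i\<in>A. p i) x = (\<Prod>i\<in>A. meval \<iota> (p i) x)"
  by (induction A rule: infinite_finite_induct) (simp_all add: meval_mult meval_one)

text \<open>The passage from the formal polynomial to the sum of products of affine forms on which
  the elimination argument operates.\<close>

lemma meval_circuit_poly:
  assumes "field_embedding \<iota>"
  shows "meval \<iota> (circuit_poly k d n c) x =
    (\<Sum>i<k. \<Prod>j<d. \<iota> (lconst (c i j)) + lin n (\<lambda>v. \<iota> (lcoeff (c i j) v)) x)"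
proof -
  have "meval \<iota> (mconst b) x = \<iota> b" for b
    by (simp add: mconst_def meval_single[OF assms])
  moreover have "meval \<iota> (mvar v) x = x v" for v
    using assms by (simp add: mvar_def meval_single[OF assms] mon_eval_def field_embedding_def)
  ultimately show ?thesis
    by (simp add: circuit_poly_def linear_mpoly_def lin_def meval_sum[OF assms] meval_prod[OF assms]
        meval_add[OF assms] meval_mult[OF assms])
qed

text \<open>Embeddings commute with sums, products and powers. This brings a nonzero value found
  over the larger field back to the field where queries are made.\<close>

lemma meval_comp:
  assumes "field_embedding \<kappa>"
  shows "meval (\<lambda>c. \<kappa> (\<iota> c)) p (\<lambda>v. \<kappa> (x v)) = \<kappa> (meval \<iota> p x)"
  using assms unfolding meval_def
  by (simp add: field_embedding_sum field_embedding_prod field_embedding_power)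
    (simp add: field_embedding_def field_embedding_prod[OF assms] field_embedding_power[OF assms])

section \<open>Digit expansions and the passage to rational functions\<close>

text \<open>The top digit contributes a multiple of \<open>B ^ L\<close>, which disturbs no lower
  digit, and the lower part stays below \<open>B ^ L\<close>. It serves both the Kronecker
  substitution and the enumeration of test points.\<close>

lemma digit_expansion:
  fixes d :: "nat \<Rightarrow> nat"
  assumes "\<And>i. i < L \<Longrightarrow> d i < B"
  shows "(\<Sum>i<L. d i * B ^ i) < B ^ L \<and> (\<forall>i<L. (\<Sum>i<L. d i * B ^ i) div B ^ i mod B = d i)"
  using assms
proof (induction L)
  case (Suc L)
  define X where "X = (\<Sum>i<L. d i * B ^ i)"
  have X: "X < B ^ L" "\<And>i. i < L \<Longrightarrow> X div B ^ i mod B = d i" using Suc by (auto simp: X_def)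
  have dL: "Suc (d L) \<le> B" using Suc.prems[of L] by simp
  have B: "B > 0" using dL by simp
  have "X + d L * B ^ L < Suc (d L) * B ^ L" using X(1) by simp
  also have "\<dots> \<le> B ^ Suc L" using mult_le_mono1[OF dL, of "B ^ L"] by simp
  finally have "X + d L * B ^ L < B ^ Suc L" .
  moreover have "(X + d L * B ^ L) div B ^ i mod B = d i" if "i < Suc L" for i
  proof (cases "i = L")
    case True
    then show ?thesis using X(1) dL B by (simp add: div_mult_self3)
  next
    case False
    then have i: "i < L" using that by simp
    have "B ^ L = B * B ^ (L - Suc i) * B ^ i"
      using i by (metis Suc_diff_Suc le_add_diff_inverse2 less_imp_le power_Suc power_add)
    then have "X + d L * B ^ L = X + (d L * (B * B ^ (L - Suc i))) * B ^ i" by simp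
    also have "\<dots> div B ^ i = d L * B ^ (L - Suc i) * B + X div B ^ i"
      using B by (subst div_mult_self1) (simp_all add: ac_simps)
    finally show ?thesis using X(2)[OF i] by simp
  qed
  ultimately show ?case by (simp add: X_def)
qed simp

lemma field_embedding_to_fract: "field_embedding (\<lambda>c :: 'b::field. to_fract [:c:])"
  by (simp add: field_embedding_def flip: to_fract_add to_fract_mult one_pCons)

text \<open>The powers of the indeterminate are pairwise distinct, whatever the size of the
  coefficient field.\<close>

lemma infinite_UNIV_poly_fract: "infinite (UNIV :: 'b::field poly fract set)"
proof
  assume "finite (UNIV :: 'b poly fract set)"
  moreover have "inj (\<lambda>i :: nat. to_fract (monom (1 :: 'b) i))"
    by (rule injI) (simp add: monom_eq_iff')
  ultimately have "finite (UNIV :: nat set)"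
    by (meson finite_imageD finite_subset subset_UNIV)
  then show False by simp
qed

text \<open>Kronecker substitution: \<open>x\<^sub>v = X ^ (B ^ v)\<close> sends distinct monomials to distinct powers of \<open>X\<close>.\<close>

lemma meval_poly_fract_nonzero:
  fixes \<iota> :: "'a::field \<Rightarrow> 'b::field"
  assumes \<iota>: "field_embedding \<iota>" and "p \<noteq> 0"
  shows "\<exists>x. meval (\<lambda>c. to_fract [:\<iota> c:]) p x \<noteq> 0"
proof -
  let ?K = "Poly_Mapping.keys p" and ?l = "Poly_Mapping.lookup"
  have fin: "finite (\<Union>m\<in>?K. Poly_Mapping.keys m)" by simp
  \<comment> \<open>\<open>N\<close> exceeds all variable indices and \<open>B\<close> all exponents
    of \<open>p\<close>, so \<open>enc m\<close> is the base-\<open>B\<close> number whose digits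
    are the exponents of \<open>m\<close>.\<close>
  then obtain N where "(\<Union>m\<in>?K. Poly_Mapping.keys m) \<subseteq> {..<N}" using finite_nat_bounded by blast
  then have N: "\<And>m v. m \<in> ?K \<Longrightarrow> v \<in> Poly_Mapping.keys m \<Longrightarrow> v < N" by blast
  have "finite (\<Union>m\<in>?K. ?l m ` {..<N})" by simp
  then obtain B where "(\<Union>m\<in>?K. ?l m ` {..<N}) \<subseteq> {..<B}" using finite_nat_bounded by blast
  then have B: "\<And>m v. m \<in> ?K \<Longrightarrow> v < N \<Longrightarrow> ?l m v < B" by blast
  define enc where "enc m = (\<Sum>v<N. ?l m v * B ^ v)" for m
  have inj: "inj_on enc ?K"
  proof (rule inj_onI, rule poly_mapping_eqI)
    fix m m' v assume m: "m \<in> ?K" "m' \<in> ?K" "enc m = enc m'"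
    show "?l m v = ?l m' v"
    proof (cases "v < N")
      case True
      have "enc m div B ^ v mod B = ?l m v" "enc m' div B ^ v mod B = ?l m' v"
        using digit_expansion[of N "?l m" B] digit_expansion[of N "?l m'" B] B[OF m(1)] B[OF m(2)] True
        by (simp_all add: enc_def)
      then show ?thesis using m(3) by simp
    next
      case False
      then show ?thesis using N m by (metis in_keys_iff)
    qed
  qed
  define x where "x v = to_fract (monom (1 :: 'b) (B ^ v))" for v
  have pow: "to_fract q ^ i = to_fract (q ^ i)" for q :: "'b poly" and i
    by (induction i) simp_all
  have prod: "(\<Prod>v\<in>A. to_fract (q v)) = to_fract (\<Prod>v\<in>A. q v)" for q :: "nat \<Rightarrow> 'b poly" and A
    by (induction A rule: infinite_finite_induct) simp_all
  have sum: "(\<Sum>m\<in>A. to_fract (q m)) = to_fract (\<Sum>m\<in>A. q m)" for q :: "_ \<Rightarrow> 'b poly" and A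
    by (induction A rule: infinite_finite_induct) simp_all
  have mprod: "(\<Prod>v\<in>A. monom (1 :: 'b) (h v)) = monom 1 (\<Sum>v\<in>A. h v)" if "finite A" for A :: "nat set" and h
    using that by (induction A rule: finite_induct) (simp_all add: mult_monom)
  have mon: "mon_eval m x = to_fract (monom 1 (enc m))" if "m \<in> ?K" for m
  proof -
    have "mon_eval m x = (\<Prod>v<N. x v ^ ?l m v)"
      by (rule mon_eval_superset) (use N that in auto)
    then show ?thesis by (simp add: x_def pow prod monom_power mprod enc_def ac_simps)
  qed
  obtain m0 where m0: "m0 \<in> ?K" using assms(2) by fastforce
  have "meval (\<lambda>c. to_fract [:\<iota> c:]) p x = (\<Sum>m\<in>?K. to_fract [:\<iota> (?l p m):] * mon_eval m x)"
    by (simp add: meval_def mon_eval_def)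
  also have "\<dots> = (\<Sum>m\<in>?K. to_fract (monom (\<iota> (?l p m)) (enc m)))"
    by (intro sum.cong refl) (simp add: mon smult_monom flip: to_fract_mult)
  also have "\<dots> = to_fract (\<Sum>m\<in>?K. monom (\<iota> (?l p m)) (enc m))" by (rule sum)
  finally have ev: "meval (\<lambda>c. to_fract [:\<iota> c:]) p x = to_fract (\<Sum>m\<in>?K. monom (\<iota> (?l p m)) (enc m))" .
  \<comment> \<open>Since \<open>enc\<close> is injective on the monomials of \<open>p\<close>, no
    other monomial can cancel the contribution of \<open>m0\<close>.\<close>
  have "coeff (\<Sum>m\<in>?K. monom (\<iota> (?l p m)) (enc m)) (enc m0) = (\<Sum>m\<in>?K. if m = m0 then \<iota> (?l p m) else 0)"
    unfolding coeff_sum using inj m0 by (intro sum.cong refl) (auto dest: inj_onD)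
  also have "\<dots> = \<iota> (?l p m0)" using m0 by simp
  also have "\<dots> \<noteq> 0" using m0 field_embedding_eq_0_iff[OF \<iota>] by (simp add: in_keys_iff)
  finally have "(\<Sum>m\<in>?K. monom (\<iota> (?l p m)) (enc m)) \<noteq> 0" by (metis coeff_0)
  then have "meval (\<lambda>c. to_fract [:\<iota> c:]) p x \<noteq> 0" unfolding ev to_fract_eq_0_iff .
  then show ?thesis by blast
qed

section \<open>A hitting set\<close>

text \<open>Restricted to the curve, a nonconstant form becomes a nonzero univariate polynomial of
  degree at most \<open>n\<close>. There are at most \<open>k * n\<close> such forms, so at most
  \<open>k * n * n\<close> parameters are bad.\<close>

lemma curve_avoids_hyperplanes:
  fixes e :: "nat \<Rightarrow> 'b::field" and C :: "'i \<Rightarrow> nat \<Rightarrow> 'b"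
  assumes A: "finite A" and nz: "\<And>i. i \<in> A \<Longrightarrow> b i \<noteq> 0 \<or> (\<exists>v<n. C i v \<noteq> 0)"
    and rd: "\<And>v. v < n \<Longrightarrow> card {i \<in> A. C i v \<noteq> 0} \<le> k"
    and e: "inj_on e {..<k * n * n + 1}"
  shows "\<exists>t < k * n * n + 1. \<forall>i\<in>A. b i + lin n (C i) (\<lambda>v. e t ^ Suc v) \<noteq> 0"
proof -
  \<comment> \<open>The powers start at 1, so each coefficient of the form occupies its own degree
    and none can cancel the constant term.\<close>
  define P where "P i = [:b i:] + (\<Sum>v<n. monom (C i v) (Suc v))" for i
  have P: "poly (P i) s = b i + lin n (C i) (\<lambda>v. s ^ Suc v)" for i s
    by (simp add: P_def lin_def poly_sum poly_monom)
  define A' where "A' = {i \<in> A. \<exists>v<n. C i v \<noteq> 0}"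
  have finA': "finite A'" using A by (simp add: A'_def)
  have "A' = (\<Union>v<n. {i \<in> A. C i v \<noteq> 0})" by (auto simp: A'_def)
  then have "card A' \<le> (\<Sum>v<n. card {i \<in> A. C i v \<noteq> 0})"
    using card_UN_le[of "{..<n}" "\<lambda>v. {i \<in> A. C i v \<noteq> 0}"] by simp
  also have "\<dots> \<le> (\<Sum>v<n. k)" by (intro sum_mono rd) simp
  finally have cardA': "card A' \<le> k * n" by (simp add: mult.commute)
  define Z where "Z i = {s. poly (P i) s = 0}" for i
  have Z: "finite (Z i) \<and> card (Z i) \<le> n" if i: "i \<in> A'" for i
  proof -
    obtain v where v: "v < n" "C i v \<noteq> 0" using i by (auto simp: A'_def)
    have "coeff (P i) (Suc v) = (\<Sum>w<n. coeff (monom (C i w) (Suc w)) (Suc v))"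
      by (simp add: P_def coeff_sum)
    also have "\<dots> = (\<Sum>w<n. if w = v then C i v else 0)" by (intro sum.cong) simp_all
    finally have "coeff (P i) (Suc v) = (\<Sum>w<n. if w = v then C i v else 0)" .
    then have "coeff (P i) (Suc v) \<noteq> 0" using v by simp
    then have P0: "P i \<noteq> 0" by auto
    have "degree (P i) \<le> n" unfolding P_def
    proof (intro degree_add_le degree_sum_le)
      show "degree (monom (C i w) (Suc w)) \<le> n" if "w \<in> {..<n}" for w
        using that degree_monom_le[of "C i w" "Suc w"] by simp
    qed simp_all
    then show ?thesis using card_poly_roots_bound[OF P0] poly_roots_finite[OF P0] by (simp add: Z_def)
  qed
  have "card (\<Union>i\<in>A'. Z i) \<le> (\<Sum>i\<in>A'. card (Z i))" by (rule card_UN_le[OF finA'])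
  also have "\<dots> \<le> (\<Sum>i\<in>A'. n)" by (intro sum_mono) (use Z in blast)
  also have "\<dots> \<le> k * n * n" using mult_le_mono1[OF cardA', of n] by simp
  also have "\<dots> < card (e ` {..<k * n * n + 1})" unfolding card_image[OF e] by simp
  finally have "\<not> e ` {..<k * n * n + 1} \<subseteq> (\<Union>i\<in>A'. Z i)"
    using card_mono[of "\<Union>i\<in>A'. Z i" "e ` {..<k * n * n + 1}"] finA' Z by fastforce
  then obtain t where t: "t < k * n * n + 1" "e t \<notin> (\<Union>i\<in>A'. Z i)" by blast
  have "b i + lin n (C i) (\<lambda>v. e t ^ Suc v) \<noteq> 0" if "i \<in> A" for i
  proof (cases "i \<in> A'")
    case True
    then show ?thesis using t(2) P by (auto simp: Z_def)
  next
    case False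
    then have "\<forall>v<n. C i v = 0" "b i \<noteq> 0" using that nz by (auto simp: A'_def)
    then show ?thesis by (simp add: lin_def)
  qed
  with t(1) show ?thesis by blast
qed

text \<open>Along a line in direction \<open>v\<close>, a factor has degree 1 if it contains this
  variable and is constant otherwise.\<close>

lemma degree_prod_affine:
  fixes b :: "'j \<Rightarrow> 'k::field"
  assumes "finite J" "v < n"
  shows "\<exists>p. degree p \<le> card {j \<in> J. C j v \<noteq> 0} \<and>
    (\<forall>t. (\<Prod>j\<in>J. b j + lin n (C j) (x(v := t))) = poly p t)"
proof (intro exI conjI allI)
  let ?p = "\<lambda>j. [:b j + lin n (C j) x - C j v * x v, C j v:]"
  show "(\<Prod>j\<in>J. b j + lin n (C j) (x(v := t))) = poly (\<Prod>j\<in>J. ?p j) t" for t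
    unfolding poly_prod using assms(2) by (intro prod.cong) (simp_all add: lin_upd algebra_simps)
  have "degree (\<Prod>j\<in>J. ?p j) \<le> (\<Sum>j\<in>J. degree (?p j))"
    using degree_prod_sum_le[OF assms(1), of ?p] by (simp add: o_def)
  also have "\<dots> \<le> (\<Sum>j\<in>J. if C j v \<noteq> 0 then 1 else 0)"
    by (intro sum_mono) simp
  also have "\<dots> = card {j \<in> J. C j v \<noteq> 0}"
    using assms(1) by (simp add: sum.If_cases Int_def)
  finally show "degree (\<Prod>j\<in>J. ?p j) \<le> card {j \<in> J. C j v \<noteq> 0}" .
qed

text \<open>The base point comes from the given field, the elimination runs over the rational
  functions, and the grid argument then moves the exceptional coordinates back to supplied elements
  of the given field.\<close>

lemma circuit_hitting_point:
  fixes c :: "'a::field depth3_circuit" and \<iota> :: "'a \<Rightarrow> 'b::field" and e :: "nat \<Rightarrow> 'b"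
  assumes k: "1 \<le> k" and n: "1 \<le> n" and rd: "read_at_most k k d n c" and \<iota>: "field_embedding \<iota>"
    and e: "inj_on e {..<k * n * n + 1}" and nz: "circuit_poly k d n c \<noteq> 0"
  shows "\<exists>t < k * n * n + 1. \<exists>S \<subseteq> {..<n}. \<exists>y. card S \<le> k * k - 1 \<and>
    (\<forall>u\<in>S. y u \<in> e ` {..<k * n * n + 1}) \<and> (\<forall>u. u \<notin> S \<longrightarrow> y u = e t ^ Suc u) \<and>
    meval \<iota> (circuit_poly k d n c) y \<noteq> 0"
proof -
  let ?B = "k * n * n + 1"
  define \<kappa> :: "'b \<Rightarrow> 'b poly fract" where "\<kappa> c = to_fract [:c:]" for c
  have \<kappa>: "field_embedding \<kappa>" using field_embedding_to_fract by (simp add: \<kappa>_def[abs_def])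
  \<comment> \<open>Terms with a formally zero factor are dropped: no base point could avoid the
    zeros of that factor.\<close>
  define I where "I = {i. i < k \<and> (\<forall>j<d. lconst (c i j) \<noteq> 0 \<or> (\<exists>v<n. lcoeff (c i j) v \<noteq> 0))}"
  define C where "C i j v = \<kappa> (\<iota> (lcoeff (c i j) v))" for i j v
  define b where "b i j = \<kappa> (\<iota> (lconst (c i j)))" for i j
  define f where "f x = (\<Sum>i\<in>I. \<Prod>j<d. b i j + lin n (C i j) x)" for x
  have finI: "finite I" by (rule finite_subset[of _ "{..<k}"]) (auto simp: I_def)
  have cardI: "card I \<le> k" using card_mono[of "{..<k}" I] by (auto simp: I_def)
  have \<kappa>0: "\<kappa> (\<iota> s) = 0 \<longleftrightarrow> s = 0" for s
    using field_embedding_eq_0_iff[OF \<kappa>] field_embedding_eq_0_iff[OF \<iota>] by simp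
  have f: "meval (\<lambda>c. \<kappa> (\<iota> c)) (circuit_poly k d n c) x = f x" for x
  proof -
    have "meval (\<lambda>c. \<kappa> (\<iota> c)) (circuit_poly k d n c) x = (\<Sum>i<k. \<Prod>j<d. b i j + lin n (C i j) x)"
      by (simp add: meval_circuit_poly[OF field_embedding_comp[OF \<iota> \<kappa>]] b_def C_def[abs_def])
    also have "\<dots> = f x" unfolding f_def
    proof (rule sum.mono_neutral_right)
      show "\<forall>i\<in>{..<k} - I. (\<Prod>j<d. b i j + lin n (C i j) x) = 0"
      proof
        fix i assume "i \<in> {..<k} - I"
        then obtain j where "j < d" "lconst (c i j) = 0" "\<forall>v<n. lcoeff (c i j) v = 0"
          by (auto simp: I_def)
        moreover from this have "b i j + lin n (C i j) x = 0"
          using \<kappa>0[of 0] by (simp add: b_def C_def lin_def)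
        ultimately show "(\<Prod>j<d. b i j + lin n (C i j) x) = 0"
          by (intro prod_zero) auto
      qed
    qed (auto simp: I_def)
    finally show ?thesis .
  qed
  have rdI: "card {(i, j). i \<in> I \<and> j < d \<and> lcoeff (c i j) v \<noteq> 0} \<le> k" if "v < n" for v
  proof (rule order_trans[OF card_mono])
    show "finite {(i, j). i < k \<and> j < d \<and> lcoeff (c i j) v \<noteq> 0}"
      by (rule finite_subset[of _ "{..<k} \<times> {..<d}"]) auto
    show "card {(i, j). i < k \<and> j < d \<and> lcoeff (c i j) v \<noteq> 0} \<le> k"
      using rd that by (simp add: read_at_most_def)
  qed (auto simp: I_def)
  have "\<exists>t < ?B. \<forall>a\<in>I \<times> {..<d}. (case a of (i, j) \<Rightarrow> \<iota> (lconst (c i j)))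
      + lin n (case a of (i, j) \<Rightarrow> \<lambda>v. \<iota> (lcoeff (c i j) v)) (\<lambda>v. e t ^ Suc v) \<noteq> 0"
  proof (rule curve_avoids_hyperplanes[OF _ _ _ e])
    show "finite (I \<times> {..<d})" using finI by simp
    show "card {a \<in> I \<times> {..<d}. (case a of (i, j) \<Rightarrow> \<lambda>v. \<iota> (lcoeff (c i j) v)) v \<noteq> 0} \<le> k" if "v < n" for v
    proof -
      have "{a \<in> I \<times> {..<d}. (case a of (i, j) \<Rightarrow> \<lambda>v. \<iota> (lcoeff (c i j) v)) v \<noteq> 0}
          = {(i, j). i \<in> I \<and> j < d \<and> lcoeff (c i j) v \<noteq> 0}"
        by (auto simp: field_embedding_eq_0_iff[OF \<iota>])
      then show ?thesis using rdI[OF that] by simp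
    qed
  qed (auto simp: I_def field_embedding_eq_0_iff[OF \<iota>])
  then obtain t where t: "t < ?B" and avoid: "\<And>i j. i \<in> I \<Longrightarrow> j < d \<Longrightarrow>
      \<iota> (lconst (c i j)) + lin n (\<lambda>v. \<iota> (lcoeff (c i j) v)) (\<lambda>v. e t ^ Suc v) \<noteq> 0"
    by fastforce
  define a where "a v = \<kappa> (e t ^ Suc v)" for v
  have avoid_a: "b i j + lin n (C i j) a \<noteq> 0" if "i \<in> I" "j < d" for i j
  proof -
    have "b i j + lin n (C i j) a
        = \<kappa> (\<iota> (lconst (c i j)) + lin n (\<lambda>v. \<iota> (lcoeff (c i j) v)) (\<lambda>v. e t ^ Suc v))"
      unfolding b_def C_def a_def lin_def
      by (simp only: field_embedding_add[OF \<kappa>] field_embedding_mult[OF \<kappa>] field_embedding_sum[OF \<kappa>])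
    then show ?thesis using avoid[OF that] field_embedding_eq_0_iff[OF \<kappa>] by simp
  qed
  obtain x where x: "f x \<noteq> 0"
    using meval_poly_fract_nonzero[OF \<iota> nz] f by (auto simp: \<kappa>_def[abs_def])
  \<comment> \<open>The elimination starts with no touched forms: \<open>R\<close> is empty and
    every \<open>Q i\<close> is 1.\<close>
  have "\<exists>S \<subseteq> {..<n}. card S + (k + 1) \<le> card ({} :: (nat \<Rightarrow> 'b poly fract) set) + card I * (k + 1) \<and>
    (\<exists>y. (\<forall>u. u \<notin> S \<longrightarrow> y u = a u) \<and> (\<Sum>i\<in>I. (\<Prod>j<d. b i j + lin n (C i j) y) * 1) \<noteq> 0)"
  proof (rule small_support_nonzero[OF infinite_UNIV_poly_fract finI refl])
    show "card {(i, j). i \<in> I \<and> j \<in> {..<d} \<and> C i j v \<noteq> 0} \<le> k" if "v < n" for v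
      using rdI[OF that] by (simp add: C_def \<kappa>0)
    show "(\<Sum>i\<in>I. (\<Prod>j<d. b i j + lin n (C i j) x) * 1) \<noteq> 0" using x by (simp add: f_def)
  qed (use avoid_a in \<open>simp_all add: polyfun_const\<close>)
  then obtain S y where S: "S \<subseteq> {..<n}" "card S + (k + 1) \<le> card I * (k + 1)"
    and y: "\<forall>u. u \<notin> S \<longrightarrow> y u = a u" "f y \<noteq> 0"
    by (auto simp: f_def)
  have finS: "finite S" using S(1) finite_subset by blast
  \<comment> \<open>The bound is \<open>(k - 1) * (k + 1) = k * k - 1\<close>.\<close>
  have "card I * (k + 1) \<le> k * (k + 1)" using cardI by (rule mult_le_mono1)
  then have cardS: "card S \<le> k * k - 1" using S(2) by simp
  have "\<exists>z. f z \<noteq> 0 \<and> (\<forall>u\<in>S. z u \<in> \<kappa> ` e ` {..<?B}) \<and> (\<forall>u. u \<notin> S \<longrightarrow> z u = y u)"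
  proof (rule polyfun_grid_nonzero[where f = f and x = y, OF finS _ _ y(2)])
    have "card (\<kappa> ` e ` {..<?B}) = ?B"
      using e field_embedding_inj[OF \<kappa>] by (simp add: card_image inj_on_subset)
    moreover have "k * 1 \<le> k * (n * n)" using n by (intro mult_le_mono2) simp
    then have "k < ?B" by (simp only: mult.assoc mult_1_right less_Suc_eq_le Suc_eq_plus1[symmetric])
    ultimately show "k < card (\<kappa> ` e ` {..<?B})" by (simp only:)
    fix x :: "nat \<Rightarrow> 'b poly fract" and v assume "v \<in> S"
    then have v: "v < n" using S(1) by blast
    have "\<forall>i\<in>I. \<exists>p. degree p \<le> k \<and> (\<forall>t. (\<Prod>j<d. b i j + lin n (C i j) (x(v := t))) = poly p t)"
    proof
      fix i assume i: "i \<in> I"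
      have "card {j \<in> {..<d}. C i j v \<noteq> 0} = card (Pair i ` {j \<in> {..<d}. C i j v \<noteq> 0})"
        by (simp add: card_image inj_on_def)
      also have "\<dots> \<le> card {(i, j). i \<in> I \<and> j < d \<and> lcoeff (c i j) v \<noteq> 0}"
      proof (rule card_mono)
        show "finite {(i, j). i \<in> I \<and> j < d \<and> lcoeff (c i j) v \<noteq> 0}"
          by (rule finite_subset[of _ "I \<times> {..<d}"]) (use finI in auto)
      qed (use i in \<open>auto simp: C_def \<kappa>0\<close>)
      also have "\<dots> \<le> k" by (rule rdI[OF v])
      finally have "card {j \<in> {..<d}. C i j v \<noteq> 0} \<le> k" .
      moreover obtain p where "degree p \<le> card {j \<in> {..<d}. C i j v \<noteq> 0}"
        "\<forall>t. (\<Prod>j<d. b i j + lin n (C i j) (x(v := t))) = poly p t"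
        using degree_prod_affine[of "{..<d}" v n "C i" "b i" x] v by blast
      ultimately show "\<exists>p. degree p \<le> k \<and> (\<forall>t. (\<Prod>j<d. b i j + lin n (C i j) (x(v := t))) = poly p t)"
        by (intro exI[of _ p]) simp
    qed
    from bchoice[OF this] obtain p where p: "\<And>i. i \<in> I \<Longrightarrow> degree (p i) \<le> k"
      "\<And>i t. i \<in> I \<Longrightarrow> (\<Prod>j<d. b i j + lin n (C i j) (x(v := t))) = poly (p i) t" by blast
    show "\<exists>p. degree p \<le> k \<and> (\<forall>t. f (x(v := t)) = poly p t)"
      by (rule exI[of _ "\<Sum>i\<in>I. p i"]) (auto simp: f_def poly_sum p intro!: degree_sum_le finI)
  qed
  then obtain z where z: "f z \<noteq> 0" "\<forall>u\<in>S. z u \<in> \<kappa> ` e ` {..<?B}" "\<forall>u. u \<notin> S \<longrightarrow> z u = y u" by blast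
  \<comment> \<open>Every coordinate of \<open>z\<close> is the image of an element of the given
    field, on the curve outside \<open>S\<close> and on the grid inside it.\<close>
  define w where "w u = inv \<kappa> (z u)" for u
  have zw: "z u = \<kappa> (w u) \<and> (u \<in> S \<longrightarrow> w u \<in> e ` {..<?B}) \<and> (u \<notin> S \<longrightarrow> w u = e t ^ Suc u)" for u
    using z(2,3) y(1) inv_f_f[OF field_embedding_inj[OF \<kappa>]] by (cases "u \<in> S") (auto simp: w_def a_def)
  then have "z = (\<lambda>u. \<kappa> (w u))" by blast
  then have "\<kappa> (meval \<iota> (circuit_poly k d n c) w) \<noteq> 0"
    using z(1) f[of z] meval_comp[OF \<kappa>, of \<iota> "circuit_poly k d n c" w] by simp
  then have "meval \<iota> (circuit_poly k d n c) w \<noteq> 0" using field_embedding_eq_0_iff[OF \<kappa>] by blast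
  with t S(1) cardS zw show ?thesis by blast
qed

section \<open>Enumeration of the test points\<close>

text \<open>A single digit sequence encodes a test point: digit 0 selects the curve parameter, and
  each following pair of digits holds a coordinate and the index of its new value. A counter in base
  \<open>B\<close> can then run through all points.\<close>

fun overwrite :: "(nat \<Rightarrow> 'b) \<Rightarrow> (nat \<Rightarrow> nat) \<Rightarrow> nat \<Rightarrow> (nat \<Rightarrow> 'b) \<Rightarrow> nat \<Rightarrow> 'b" where
  "overwrite e D 0 x = x"
| "overwrite e D (Suc i) x = (overwrite e D i x)(D (2 * i + 1) := e (D (2 * i + 2)))"

definition test_point :: "(nat \<Rightarrow> 'b::field) \<Rightarrow> nat \<Rightarrow> (nat \<Rightarrow> nat) \<Rightarrow> nat \<Rightarrow> 'b" where
  "test_point e m D = overwrite e D m (\<lambda>v. e (D 0) ^ Suc v)"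

lemma overwrite_cong: "(\<And>i. i < 2 * m + 1 \<Longrightarrow> D i = D' i) \<Longrightarrow> overwrite e D m x = overwrite e D' m x"
  by (induction m) simp_all

lemma test_point_cong: "(\<And>i. i < 2 * m + 1 \<Longrightarrow> D i = D' i) \<Longrightarrow> test_point e m D = test_point e m D'"
  using overwrite_cong[of m D D'] unfolding test_point_def by simp

lemma test_point_covers:
  assumes S: "S \<subseteq> {..<n}" "card S \<le> m" and B: "t < B" "n < B"
    and y: "\<And>u. u \<in> S \<Longrightarrow> y u \<in> e ` {..<B}" "\<And>u. u \<notin> S \<Longrightarrow> y u = e t ^ Suc u"
  shows "\<exists>D. (\<forall>i. D i < B) \<and> (\<forall>v<n. test_point e m D v = y v)"
proof -
  have "finite S" using S(1) finite_subset by blast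
  then obtain us where us: "set us = S" "length us = card S" using finite_distinct_list distinct_card by metis
  have "\<forall>u\<in>S. \<exists>w<B. y u = e w" using y(1) by blast
  then obtain w where w: "\<And>u. u \<in> S \<Longrightarrow> w u < B" "\<And>u. u \<in> S \<Longrightarrow> y u = e (w u)" by metis
  \<comment> \<open>If \<open>S\<close> has fewer than \<open>m\<close> elements, the spare
    overwrites go to coordinate \<open>n\<close>, which is beyond the variables;
    \<open>n < B\<close> makes it a legal digit.\<close>
  define D where "D i = (if i = 0 then t else if (i - 1) div 2 < length us
    then if odd i then us ! ((i - 1) div 2) else w (us ! ((i - 1) div 2)) else if odd i then n else 0)" for i
  have nth: "us ! j \<in> S" if "j < length us" for j using that us(1) by auto
  then have "us ! j < B" if "j < length us" for j using that S(1) B(2) by fastforce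
  then have "D i < B" for i using B w(1)[OF nth] by (auto simp: D_def)
  have D1: "D (2 * i + 1) = (if i < length us then us ! i else n)"
    and D2: "i < length us \<Longrightarrow> D (2 * i + 2) = w (us ! i)" for i
    by (simp_all add: D_def)
  have ov: "overwrite e D i x v = (if v \<in> set (take i us) then y v else x v)" if "v < n" for i x v
  proof (induction i)
    case (Suc i)
    show ?case
    proof (cases "i < length us")
      case True
      then show ?thesis
        using Suc D1[of i] D2[of i] w(2)[OF nth[OF True]] by (auto simp: take_Suc_conv_app_nth)
    next
      case False
      then show ?thesis using Suc D1[of i] that by simp
    qed
  qed simp
  have "test_point e m D v = y v" if "v < n" for v
    unfolding test_point_def ov[OF that] using us S(2) y(2)[of v] by (simp add: D_def)
  with \<open>\<And>i. D i < B\<close> show ?thesis by blast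
qed

text \<open>A hitting point is described by \<open>2 * m + 1\<close> digits below \<open>B\<close>,
  and these are the base-\<open>B\<close> digits of some \<open>j\<close> in the range.\<close>

lemma circuit_zero_iff_test_points:
  fixes c :: "'a::field depth3_circuit" and \<iota> :: "'a \<Rightarrow> 'b::field" and e :: "nat \<Rightarrow> 'b"
  assumes k: "1 \<le> k" and n: "1 \<le> n" and rd: "read_at_most k k d n c" and \<iota>: "field_embedding \<iota>"
    and B: "B = k * n * n + 1" and e: "inj_on e {..<B}" and m: "m = k * k - 1"
  shows "circuit_poly k d n c = 0 \<longleftrightarrow>
    (\<forall>j < B ^ (2 * m + 1). meval \<iota> (circuit_poly k d n c) (test_point e m (\<lambda>i. j div B ^ i mod B)) = 0)"
proof
  assume all: "\<forall>j < B ^ (2 * m + 1). meval \<iota> (circuit_poly k d n c) (test_point e m (\<lambda>i. j div B ^ i mod B)) = 0"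
  show "circuit_poly k d n c = 0"
  proof (rule ccontr)
    assume "circuit_poly k d n c \<noteq> 0"
    from circuit_hitting_point[OF k n rd \<iota> e[unfolded B] this] obtain t S y
      where t: "t < B" and S: "S \<subseteq> {..<n}" "card S \<le> m"
        and y: "\<forall>u\<in>S. y u \<in> e ` {..<B}" "\<forall>u. u \<notin> S \<longrightarrow> y u = e t ^ Suc u"
        and nz: "meval \<iota> (circuit_poly k d n c) y \<noteq> 0" unfolding B m by blast
    have "1 * n \<le> (k * n) * n" by (rule mult_le_mono1) (use k n in simp)
    then have "n < B" unfolding B by (simp only: mult_1 less_Suc_eq_le Suc_eq_plus1[symmetric])
    then obtain D where D: "\<forall>i. D i < B" "\<forall>v<n. test_point e m D v = y v"
      using test_point_covers[OF S t, of y e] y by blast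
    define j where "j = (\<Sum>i<2 * m + 1. D i * B ^ i)"
    have j: "j < B ^ (2 * m + 1)" "\<And>i. i < 2 * m + 1 \<Longrightarrow> j div B ^ i mod B = D i"
      using digit_expansion[of "2 * m + 1" D B] D(1) unfolding j_def by blast+
    have pt: "test_point e m (\<lambda>i. j div B ^ i mod B) = test_point e m D"
      by (rule test_point_cong) (rule j(2))
    have lin: "lin n a y = lin n a (test_point e m D)" for a
      by (rule lin_cong) (use D(2) in simp)
    have "meval \<iota> (circuit_poly k d n c) y = meval \<iota> (circuit_poly k d n c) (test_point e m D)"
      unfolding meval_circuit_poly[OF \<iota>] lin ..
    then show False using nz all j(1) pt by metis
  qed
qed simp

section \<open>The program\<close>

text \<open>A weakest precondition for total correctness whose postcondition also sees the exact
  number of steps.\<close>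

definition runs :: "(nat \<Rightarrow> 'f::field) \<Rightarrow> ((nat \<Rightarrow> 'f) \<Rightarrow> 'f) \<Rightarrow> com \<Rightarrow> (nat \<Rightarrow> 'f state \<Rightarrow> bool) \<Rightarrow> 'f state \<Rightarrow> bool"
  where "runs e f p Q s \<longleftrightarrow> (\<exists>t s'. exec e f p s t s' \<and> Q t s')"

lemma runs_mono: "runs e f p Q s \<Longrightarrow> (\<And>t s'. Q t s' \<Longrightarrow> Q' t s') \<Longrightarrow> runs e f p Q' s"
  unfolding runs_def by blast

text \<open>Determinism yields an equivalence, so straight-line code can be executed symbolically by
  rewriting.\<close>

lemma runs_atomic: "atomic e f p s = Some s' \<Longrightarrow> runs e f p Q s \<longleftrightarrow> Q 1 s'"
  unfolding runs_def by (metis exec.atomic exec_deterministic)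

lemma runs_Seq: "runs e f (Seq p q) Q s \<longleftrightarrow> runs e f p (\<lambda>t s'. runs e f q (\<lambda>u s''. Q (t + u) s'') s') s"
  unfolding runs_def by (fastforce elim: exec_SeqE intro: exec.seq)

lemma runs_Cond:
  "runs e f (Cond b p q) Q s \<longleftrightarrow> runs e f (if holds b s then p else q) (\<lambda>t s'. Q (Suc t) s') s"
  unfolding runs_def by (auto elim!: exec_CondE intro: exec.cond_true exec.cond_false)

lemmas runs_simps = runs_Seq runs_Cond runs_atomic[OF atomic.simps(1)] runs_atomic[OF atomic.simps(2)]
  runs_atomic[OF atomic.simps(3)] runs_atomic[OF atomic.simps(4)] runs_atomic[OF atomic.simps(5)]
  runs_atomic[OF atomic.simps(6)] runs_atomic[OF atomic.simps(7)] runs_atomic[OF atomic.simps(8)]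
  runs_atomic[OF atomic.simps(9)] runs_atomic[OF atomic.simps(10)] runs_atomic[OF atomic.simps(11)]
  runs_atomic[OF atomic.simps(12)] runs_atomic[OF atomic.simps(13)] runs_atomic[OF atomic.simps(14)]
  runs_atomic[OF atomic.simps(15)] runs_atomic[OF atomic.simps(16)] set_reg_def set_cell_def cell_def

text \<open>Induction on the number of remaining iterations. Each one pays its body and one test,
  and the failing test at the end costs one more step.\<close>

lemma runs_While:
  assumes step: "\<And>i s. i < m \<Longrightarrow> I i s \<Longrightarrow> holds b s \<and> runs e f p (\<lambda>t s'. t \<le> T \<and> I (Suc i) s') s"
    and final: "\<And>s. I m s \<Longrightarrow> \<not> holds b s" and init: "I 0 s"
  shows "runs e f (While b p) (\<lambda>t s'. t \<le> m * (T + 1) + 1 \<and> I m s') s"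
proof -
  have "runs e f (While b p) (\<lambda>t s'. t \<le> i * (T + 1) + 1 \<and> I m s') s" if "i \<le> m" "I (m - i) s" for i s
    using that
  proof (induction i arbitrary: s)
    case 0
    then show ?case using final[of s] exec.while_false[of b s e f p] unfolding runs_def by auto
  next
    case (Suc i)
    then have "m - Suc i < m" "Suc (m - Suc i) = m - i" by simp_all
    with step[of "m - Suc i" s] Suc.prems obtain t s' where
      1: "holds b s" "exec e f p s t s'" "t \<le> T" "I (m - i) s'" unfolding runs_def by auto
    with Suc.IH[of s'] Suc.prems obtain u s'' where
      2: "exec e f (While b p) s' u s''" "u \<le> i * (T + 1) + 1" "I m s''" unfolding runs_def by auto
    have "exec e f (While b p) s (Suc (t + u)) s''" using 1 2 exec.while_true by blast
    moreover have "Suc (t + u) \<le> Suc i * (T + 1) + 1" using 1 2 by simp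
    ultimately show ?case using 2(3) unfolding runs_def by blast
  qed
  from this[of m s] init show ?thesis by simp
qed

text \<open>A counting loop. Register 16 is the shared counter, so such loops are never nested;
  register 11 supplies the increment 1.\<close>

definition loop :: "nat \<Rightarrow> com \<Rightarrow> com" where
  "loop b p = Seq (NatConst 16 0) (While (Less 16 b) (Seq p (NatAdd 16 16 11)))"

lemma runs_loop:
  assumes "\<And>i s. i < m \<Longrightarrow> I i s \<Longrightarrow> reg s 16 = i \<Longrightarrow>
      runs e f p (\<lambda>t s'. t \<le> T \<and> reg s' 16 = i \<and> I (Suc i) (set_reg 16 (Suc i) s')) s"
    and "\<And>i s. I i s \<Longrightarrow> reg s b = m \<and> reg s 11 = 1"
    and "I 0 (set_reg 16 0 s)" and "b \<noteq> 16"
  shows "runs e f (loop b p) (\<lambda>t s'. t \<le> m * (T + 2) + 2 \<and> I m s') s"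
proof -
  define I' where "I' i s \<longleftrightarrow> I i s \<and> reg s 16 = i" for i s
  have "runs e f (While (Less 16 b) (Seq p (NatAdd 16 16 11)))
      (\<lambda>t s'. t \<le> m * ((T + 1) + 1) + 1 \<and> I' m s') (set_reg 16 0 s)"
  proof (rule runs_While)
    fix i s assume i: "i < m" and I': "I' i s"
    have "runs e f p (\<lambda>t s'. t \<le> T \<and> reg s' 16 = i \<and> I (Suc i) (set_reg 16 (Suc i) s')) s"
      using assms(1)[OF i] I' by (simp add: I'_def)
    then have "runs e f (Seq p (NatAdd 16 16 11)) (\<lambda>t s'. t \<le> T + 1 \<and> I' (Suc i) s') s"
      unfolding runs_Seq
    proof (rule runs_mono)
      fix t s' assume s': "t \<le> T \<and> reg s' 16 = i \<and> I (Suc i) (set_reg 16 (Suc i) s')"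
      then have "reg s' 11 = 1" using assms(2)[of "Suc i" "set_reg 16 (Suc i) s'"] by (simp add: set_reg_def)
      then show "runs e f (NatAdd 16 16 11) (\<lambda>u s''. t + u \<le> T + 1 \<and> I' (Suc i) s'') s'"
        using s' by (simp add: runs_simps I'_def)
    qed
    then show "holds (Less 16 b) s \<and> runs e f (Seq p (NatAdd 16 16 11)) (\<lambda>t s'. t \<le> T + 1 \<and> I' (Suc i) s') s"
      using assms(2)[of i s] I' i by (simp add: I'_def)
  next
    show "\<not> holds (Less 16 b) s" if "I' m s" for s using assms(2)[of m s] that by (simp add: I'_def)
    show "I' 0 (set_reg 16 0 s)" using assms(3) by (simp add: I'_def set_reg_def)
  qed
  then have "runs e f (While (Less 16 b) (Seq p (NatAdd 16 16 11)))
      (\<lambda>t s'. 1 + t \<le> m * (T + 2) + 2 \<and> I m s') (set_reg 16 0 s)"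
    by (rule runs_mono) (simp add: I'_def)
  then show ?thesis by (simp add: loop_def runs_simps)
qed

text \<open>The machine cannot multiply natural numbers, so the product is accumulated by repeated
  addition, in time linear in register \<open>c\<close>.\<close>

definition mult_add :: "nat \<Rightarrow> nat \<Rightarrow> nat \<Rightarrow> com" where
  "mult_add a b c = loop c (NatAdd a a b)"

lemma runs_mult_add:
  assumes "reg s 11 = 1" "a \<notin> {b, c, 11, 16}" "b \<noteq> 16" "c \<noteq> 16"
  shows "runs e f (mult_add a b c) (\<lambda>t s'. t \<le> 3 * reg s c + 2 \<and>
    s' = s\<lparr>reg := (reg s)(a := reg s a + reg s c * reg s b, 16 := reg s c)\<rparr>) s"
proof -
  define I where "I i s' \<longleftrightarrow> s' = s\<lparr>reg := (reg s)(a := reg s a + i * reg s b, 16 := i)\<rparr>" for i s'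
  have "runs e f (loop c (NatAdd a a b)) (\<lambda>t s'. t \<le> reg s c * (1 + 2) + 2 \<and> I (reg s c) s') s"
    by (rule runs_loop) (use assms in \<open>auto simp: I_def runs_simps fun_eq_iff algebra_simps\<close>)
  then show ?thesis unfolding mult_add_def by (rule runs_mono) (simp add: I_def)
qed

text \<open>
  Registers: 1 answer, 2 number of variables, 3 base, 4 number of overwritten coordinates,
  5 number of digits, 10--14 the constants 0--4, 15 carry, 16 loop counter. Field cell 0 holds 0,
  cell 1 the curve parameter, cell 2 its current power, cell 3 the queried value, and the point
  starts at cell 4. The digits are in \<open>nmem\<close>.
\<close>

definition layout :: "nat \<Rightarrow> nat \<Rightarrow> nat \<Rightarrow> 'f::zero state \<Rightarrow> bool" where
  "layout n B m s \<longleftrightarrow> reg s 2 = n \<and> reg s 3 = B \<and> reg s 4 = m \<and> reg s 5 = 2 * m + 1 \<and>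
     reg s 10 = 0 \<and> reg s 11 = 1 \<and> reg s 12 = 2 \<and> reg s 13 = 3 \<and> reg s 14 = 4 \<and> fmem s 0 = 0"

section \<open>Writing a point and advancing the digits\<close>

text \<open>The constants in registers 11 and 12 double as addresses of the parameter and its power.
  Multiplying before copying makes coordinate \<open>v\<close> the power
  \<open>Suc v\<close>.\<close>

definition write_curve :: com where
  "write_curve = Seq (NatLoad 6 10) (Seq (FieldElem 11 6) (Seq (FieldOne 12) (Seq (NatCopy 7 14)
     (loop 2 (Seq (FieldMul 12 12 11) (Seq (FieldCopy 7 12) (NatAdd 7 7 11)))))))"

lemma runs_write_curve:
  assumes "layout n B m s"
  shows "runs e f write_curve (\<lambda>t s'. t \<le> 5 * n + 6 \<and> layout n B m s' \<and> nmem s' = nmem s \<and>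
    reg s' 1 = reg s 1 \<and> (\<forall>v<n. fmem s' (4 + v) = e (nmem s 0) ^ Suc v)) s"
proof -
  define \<tau> where "\<tau> = e (nmem s 0)"
  define I where "I i s' \<longleftrightarrow> layout n B m s' \<and> nmem s' = nmem s \<and> reg s' 1 = reg s 1 \<and> reg s' 7 = 4 + i \<and>
    fmem s' 1 = \<tau> \<and> fmem s' 2 = \<tau> ^ i \<and> (\<forall>v<i. fmem s' (4 + v) = \<tau> ^ Suc v)" for i s'
  define s0 where "s0 = s\<lparr>fmem := (fmem s)(1 := \<tau>, 2 := 1), reg := (reg s)(6 := nmem s 0, 7 := 4)\<rparr>"
  have "runs e f (loop 2 (Seq (FieldMul 12 12 11) (Seq (FieldCopy 7 12) (NatAdd 7 7 11))))
      (\<lambda>t s'. t \<le> n * (3 + 2) + 2 \<and> I n s') s0"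
    by (rule runs_loop)
      (use assms in \<open>auto simp: I_def layout_def runs_simps s0_def less_Suc_eq algebra_simps\<close>)
  then have "runs e f (loop 2 (Seq (FieldMul 12 12 11) (Seq (FieldCopy 7 12) (NatAdd 7 7 11))))
      (\<lambda>t s'. 4 + t \<le> 5 * n + 6 \<and> layout n B m s' \<and> nmem s' = nmem s \<and>
        reg s' 1 = reg s 1 \<and> (\<forall>v<n. fmem s' (4 + v) = \<tau> ^ Suc v)) s0"
    by (rule runs_mono) (simp add: I_def)
  moreover have "s0 = s\<lparr>fmem := (fmem s)(Suc 0 := e (nmem s 0), 2 := 1), reg := (reg s)(6 := nmem s 0, 7 := 4)\<rparr>"
    by (simp add: s0_def \<tau>_def)
  ultimately show ?thesis
    using assms by (simp add: write_curve_def runs_simps layout_def \<tau>_def)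
qed

definition overwrite_point :: com where
  "overwrite_point = Seq (NatConst 8 1) (loop 4 (Seq (NatLoad 6 8) (Seq (NatAdd 8 8 11) (Seq (NatAdd 6 6 14)
     (Seq (NatLoad 9 8) (Seq (NatAdd 8 8 11) (FieldElem 6 9)))))))"

text \<open>Adding 4 to the coordinate keeps the work cells 0 to 3 intact, and a coordinate not
  below \<open>n\<close> only reaches cells past the point.\<close>

lemma runs_overwrite_point:
  assumes "layout n B m s" and "\<And>v. v < n \<Longrightarrow> fmem s (4 + v) = x v"
  shows "runs e f overwrite_point (\<lambda>t s'. t \<le> 8 * m + 3 \<and> layout n B m s' \<and> nmem s' = nmem s \<and>
    reg s' 1 = reg s 1 \<and> (\<forall>v<n. fmem s' (4 + v) = overwrite e (nmem s) m x v)) s"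
proof -
  let ?p = "Seq (NatLoad 6 8) (Seq (NatAdd 8 8 11) (Seq (NatAdd 6 6 14) (Seq (NatLoad 9 8) (Seq (NatAdd 8 8 11) (FieldElem 6 9)))))"
  define I where "I i s' \<longleftrightarrow> layout n B m s' \<and> nmem s' = nmem s \<and> reg s' 1 = reg s 1 \<and> reg s' 8 = 2 * i + 1 \<and>
    (\<forall>v<n. fmem s' (4 + v) = overwrite e (nmem s) i x v)" for i s'
  have "runs e f (loop 4 ?p) (\<lambda>t s'. t \<le> m * (6 + 2) + 2 \<and> I m s') (s\<lparr>reg := (reg s)(8 := 1)\<rparr>)"
    by (rule runs_loop) (use assms in \<open>auto simp: I_def layout_def runs_simps\<close>)
  then have "runs e f (loop 4 ?p) (\<lambda>t s'. 1 + t \<le> 8 * m + 3 \<and> layout n B m s' \<and> nmem s' = nmem s \<and>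
    reg s' 1 = reg s 1 \<and> (\<forall>v<n. fmem s' (4 + v) = overwrite e (nmem s) m x v)) (s\<lparr>reg := (reg s)(8 := 1)\<rparr>)"
    by (rule runs_mono) (simp add: I_def)
  then show ?thesis by (simp add: overwrite_point_def runs_simps)
qed

text \<open>Incrementing the base-\<open>B\<close> counter: the initial carry 1 is the summand, and
  the loop counter doubles as the digit position.\<close>

definition next_digits :: com where
  "next_digits = Seq (NatConst 15 1) (loop 5 (Seq (NatLoad 6 16) (Seq (NatAdd 6 6 15)
     (Cond (Less 6 3) (Seq (NatStore 16 6) (NatConst 15 0)) (NatStore 16 10)))))"

text \<open>The carry into position \<open>i\<close> is 1 exactly if \<open>B ^ i\<close> divides
  \<open>Suc j\<close>, since only then does the quotient by \<open>B ^ i\<close> grow.\<close>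

lemma digit_carry:
  fixes j B i :: nat
  assumes "B > 0"
  defines "w \<equiv> j div B ^ i mod B + (if B ^ i dvd Suc j then 1 else 0)"
  shows "w < B \<Longrightarrow> Suc j div B ^ i mod B = w \<and> \<not> B ^ Suc i dvd Suc j"
    and "\<not> w < B \<Longrightarrow> Suc j div B ^ i mod B = 0 \<and> B ^ Suc i dvd Suc j"
proof -
  have div: "Suc j div B ^ i = j div B ^ i + (if B ^ i dvd Suc j then 1 else 0)"
    by (simp add: div_Suc dvd_eq_mod_eq_0)
  have dvd: "B ^ Suc i dvd Suc j \<longleftrightarrow> B ^ i dvd Suc j \<and> Suc j div B ^ i mod B = 0"
  proof
    assume "B ^ Suc i dvd Suc j"
    then obtain r where r: "Suc j = B ^ Suc i * r" by blast
    then have "Suc j = B ^ i * (B * r)" by simp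
    then show "B ^ i dvd Suc j \<and> Suc j div B ^ i mod B = 0" using assms(1) by simp
  next
    assume "B ^ i dvd Suc j \<and> Suc j div B ^ i mod B = 0"
    then obtain r where "Suc j = B ^ i * r" "r mod B = 0" using assms(1) by auto
    then show "B ^ Suc i dvd Suc j" by auto
  qed
  have mod: "(q + 1) mod B = (if q mod B + 1 < B then q mod B + 1 else 0)" for q
    using mod_less_divisor[OF assms(1), of q] by (simp add: mod_Suc)
  have lt: "j div B ^ i mod B < B" using assms(1) by simp
  show "w < B \<Longrightarrow> Suc j div B ^ i mod B = w \<and> \<not> B ^ Suc i dvd Suc j"
    unfolding dvd unfolding div using mod[of "j div B ^ i"] by (auto simp: w_def)
  show "\<not> w < B \<Longrightarrow> Suc j div B ^ i mod B = 0 \<and> B ^ Suc i dvd Suc j"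
    unfolding dvd unfolding div using mod[of "j div B ^ i"] lt by (auto simp: w_def split: if_splits)
qed

lemma runs_next_digits:
  fixes s :: "'f::field state"
  assumes "layout n B m s" and "B > 0" and "\<forall>i < 2 * m + 1. nmem s i = j div B ^ i mod B"
  shows "runs e f next_digits (\<lambda>t s'. t \<le> 7 * (2 * m + 1) + 3 \<and> layout n B m s' \<and> reg s' 1 = reg s 1 \<and>
    reg s' 15 = (if B ^ (2 * m + 1) dvd Suc j then 1 else 0) \<and>
    (\<forall>i < 2 * m + 1. nmem s' i = Suc j div B ^ i mod B)) s"
proof -
  let ?p = "Seq (NatLoad 6 16) (Seq (NatAdd 6 6 15) (Cond (Less 6 3) (Seq (NatStore 16 6) (NatConst 15 0)) (NatStore 16 10)))"
  \<comment> \<open>Digits below the current position already belong to \<open>Suc j\<close>, the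
    others still to \<open>j\<close>. The carry left at the end reports an overflow of the
    counter.\<close>
  define I where "I i s' \<longleftrightarrow> layout n B m s' \<and> reg s' 1 = reg s 1 \<and> reg s' 15 = (if B ^ i dvd Suc j then 1 else 0) \<and>
    (\<forall>l < 2 * m + 1. nmem s' l = (if l < i then Suc j else j) div B ^ l mod B)" for i and s' :: "'f state"
  have "runs e f (loop 5 ?p) (\<lambda>t s'. t \<le> (2 * m + 1) * (5 + 2) + 2 \<and> I (2 * m + 1) s') (s\<lparr>reg := (reg s)(15 := 1)\<rparr>)"
  proof (rule runs_loop)
    fix i s' assume i: "i < 2 * m + 1" and I: "I i s'" and r16: "reg s' 16 = i"
    define w where "w = j div B ^ i mod B + (if B ^ i dvd Suc j then 1 else 0)"
    have regs: "reg s' 3 = B" "reg s' 10 = 0" "nmem s' i + reg s' 15 = w"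
      using I i by (simp_all add: I_def layout_def w_def)
    show "runs e f ?p (\<lambda>t s'. t \<le> 5 \<and> reg s' 16 = i \<and> I (Suc i) (set_reg 16 (Suc i) s')) s'"
    proof (cases "w < B")
      case True
      then show ?thesis
        using I i r16 regs digit_carry(1)[OF assms(2), of j i, folded w_def]
        by (auto simp: I_def layout_def runs_simps)
    next
      case False
      then show ?thesis
        using I i r16 regs digit_carry(2)[OF assms(2), of j i, folded w_def]
        by (auto simp: I_def layout_def runs_simps)
    qed
  qed (use assms in \<open>auto simp: I_def layout_def runs_simps\<close>)
  then have "runs e f (loop 5 ?p) (\<lambda>t s'. 1 + t \<le> 7 * (2 * m + 1) + 3 \<and> layout n B m s' \<and> reg s' 1 = reg s 1 \<and>
    reg s' 15 = (if B ^ (2 * m + 1) dvd Suc j then 1 else 0) \<and>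
    (\<forall>i < 2 * m + 1. nmem s' i = Suc j div B ^ i mod B)) (s\<lparr>reg := (reg s)(15 := 1)\<rparr>)"
    by (rule runs_mono) (simp add: I_def)
  then show ?thesis by (simp add: next_digits_def runs_simps)
qed

definition visit_point :: com where
  "visit_point = Seq write_curve (Seq overwrite_point (Seq (Query 13 14)
     (Seq (Cond (FieldEq 13 10) Skip (NatConst 1 0)) next_digits)))"

lemma runs_visit_point:
  fixes s :: "'f::field state"
  assumes "layout n B m s" and "B > 0" and digits: "\<forall>i < 2 * m + 1. nmem s i = j div B ^ i mod B"
    and loc: "\<And>x y. (\<And>v. v < n \<Longrightarrow> x v = y v) \<Longrightarrow> f x = f y"
  shows "runs e f visit_point (\<lambda>t s'. t \<le> 5 * n + 22 * m + 22 \<and> layout n B m s' \<and>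
    reg s' 1 = (if f (test_point e m (\<lambda>i. j div B ^ i mod B)) = 0 then reg s 1 else 0) \<and>
    reg s' 15 = (if B ^ (2 * m + 1) dvd Suc j then 1 else 0) \<and>
    (\<forall>i < 2 * m + 1. nmem s' i = Suc j div B ^ i mod B)) s"
  unfolding visit_point_def runs_Seq
proof (rule runs_mono[OF runs_write_curve[OF assms(1)]])
  let ?D = "\<lambda>i. j div B ^ i mod B"
  let ?Q = "\<lambda>t s'. t \<le> 5 * n + 22 * m + 22 \<and> layout n B m s' \<and>
    reg s' 1 = (if f (test_point e m ?D) = 0 then reg s 1 else 0) \<and>
    reg s' 15 = (if B ^ (2 * m + 1) dvd Suc j then 1 else 0) \<and>
    (\<forall>i < 2 * m + 1. nmem s' i = Suc j div B ^ i mod B)"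
  fix t1 s1 assume 1: "t1 \<le> 5 * n + 6 \<and> layout n B m s1 \<and> nmem s1 = nmem s \<and>
    reg s1 1 = reg s 1 \<and> (\<forall>v<n. fmem s1 (4 + v) = e (nmem s 0) ^ Suc v)"
  let ?x = "\<lambda>v. e (nmem s 0) ^ Suc v"
  have l1: "layout n B m s1" and x1: "fmem s1 (4 + v) = ?x v" if "v < n" for v using 1 that by simp_all
  show "runs e f overwrite_point (\<lambda>t2. runs e f (Query 13 14) (\<lambda>t3. runs e f (Cond (FieldEq 13 10) Skip (NatConst 1 0))
      (\<lambda>t4. runs e f next_digits (\<lambda>t5. ?Q (t1 + (t2 + (t3 + (t4 + t5)))))))) s1"
  proof (rule runs_mono[OF runs_overwrite_point[of n B m s1 ?x]])
    fix t2 s2 assume 2: "t2 \<le> 8 * m + 3 \<and> layout n B m s2 \<and> nmem s2 = nmem s1 \<and>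
      reg s2 1 = reg s1 1 \<and> (\<forall>v<n. fmem s2 (4 + v) = overwrite e (nmem s1) m ?x v)"
    have "test_point e m (nmem s) = test_point e m ?D"
      by (rule test_point_cong) (use digits in simp)
    \<comment> \<open>Cells past the first \<open>n\<close> coordinates may hold leftovers, so the
      queried point is identified with the test point only through \<open>loc\<close>.\<close>
    then have q: "f (\<lambda>i. fmem s2 (4 + i)) = f (test_point e m ?D)"
      using 1 2 by (intro loc) (metis test_point_def)
    define s4 where "s4 = s2\<lparr>fmem := (fmem s2)(3 := f (test_point e m ?D)),
      reg := (if f (test_point e m ?D) = 0 then reg s2 else (reg s2)(1 := 0))\<rparr>"
    have l4: "layout n B m s4" and d4: "\<forall>i < 2 * m + 1. nmem s4 i = ?D i"
      and a4: "reg s4 1 = (if f (test_point e m ?D) = 0 then reg s 1 else 0)"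
      using 1 2 digits by (auto simp: s4_def layout_def)
    have "runs e f next_digits (\<lambda>t5. ?Q (t1 + (t2 + (1 + (2 + t5))))) s4"
      by (rule runs_mono[OF runs_next_digits[OF l4 \<open>B > 0\<close> d4]]) (use 1 2 a4 in auto)
    then show "runs e f (Query 13 14) (\<lambda>t3. runs e f (Cond (FieldEq 13 10) Skip (NatConst 1 0))
      (\<lambda>t4. runs e f next_digits (\<lambda>t5. ?Q (t1 + (t2 + (t3 + (t4 + t5))))))) s2"
      using 2 q by (cases "f (test_point e m ?D) = 0") (simp_all add: runs_simps s4_def layout_def)
  qed (use 1 in simp_all)
qed

text \<open>The repetition counts of the three products are \<open>n\<close>, \<open>n\<close> and
  \<open>k\<close>; this keeps the setup linear in \<open>n\<close> and \<open>k\<close>.\<close>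

definition compute_layout :: com where
  "compute_layout = Seq (NatConst 11 1) (Seq (NatConst 12 2) (Seq (NatConst 13 3) (Seq (NatConst 14 4)
     (Seq (NatConst 1 1) (Seq (mult_add 9 0 2) (Seq (mult_add 3 9 2) (Seq (NatAdd 3 3 11)
     (Seq (mult_add 4 0 0) (Seq (NatSub 4 4 11) (Seq (NatAdd 5 4 4) (NatAdd 5 5 11)))))))))))"

lemma runs_compute_layout:
  "runs e f compute_layout (\<lambda>t s. t \<le> 6 * n + 3 * k + 15 \<and> layout n (k * n * n + 1) (k * k - 1) s \<and>
    reg s 1 = 1 \<and> reg s 15 = 0 \<and> nmem s = (\<lambda>_. 0)) (initial_state k d n)"
proof -
  have mult: "runs e f (mult_add a b c) Q s" if "reg s 11 = 1" "a \<notin> {b, c, 11, 16}" "b \<noteq> 16" "c \<noteq> 16"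
    "\<And>t. t \<le> 3 * reg s c + 2 \<Longrightarrow> Q t (s\<lparr>reg := (reg s)(a := reg s a + reg s c * reg s b, 16 := reg s c)\<rparr>)"
    for a b c Q and s :: "'a state"
    by (rule runs_mono[OF runs_mult_add[OF that(1-4)]]) (use that(5) in blast)
  show ?thesis
    unfolding compute_layout_def
    apply (simp add: runs_simps initial_state_def)
    apply (rule mult; simp add: runs_simps)
    apply (rule mult; simp add: runs_simps)
    apply (rule mult; simp add: runs_simps layout_def algebra_simps)
    done
qed

text \<open>Register 15, the carry out of the counter, also controls the loop: it becomes 1 once all
  test points have been visited.\<close>

definition identity_test :: com where
  "identity_test = Seq compute_layout (Seq (While (Less 15 11) visit_point) (NatCopy 0 1))"

lemma halts_with_identity_test:
  fixes e :: "nat \<Rightarrow> 'f::field"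
  assumes B: "B = k * n * n + 1" and m: "m = k * k - 1"
    and loc: "\<And>x y. (\<And>v. v < n \<Longrightarrow> x v = y v) \<Longrightarrow> f x = f y"
  shows "\<exists>t. halts_with e f identity_test k d n t
      (\<forall>j < B ^ (2 * m + 1). f (test_point e m (\<lambda>i. j div B ^ i mod B)) = 0) \<and>
    t \<le> B ^ (2 * m + 1) * (5 * n + 22 * m + 23) + 6 * n + 3 * k + 17"
proof -
  let ?N = "B ^ (2 * m + 1)" and ?z = "\<lambda>j. f (test_point e m (\<lambda>i. j div B ^ i mod B)) = 0"
  have B0: "B > 0" using B by simp
  define I where "I j s \<longleftrightarrow> layout n B m s \<and> reg s 1 = (if \<forall>i<j. ?z i then 1 else 0) \<and>
    reg s 15 = (if j = ?N then 1 else 0) \<and> (\<forall>i < 2 * m + 1. nmem s i = j div B ^ i mod B)" for j and s :: "'f state"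
  have main: "runs e f (While (Less 15 11) visit_point)
      (\<lambda>t s. t \<le> ?N * (5 * n + 22 * m + 23) + 1 \<and> I ?N s) s" if "I 0 s" for s
  proof -
    have "runs e f (While (Less 15 11) visit_point)
      (\<lambda>t s. t \<le> ?N * (5 * n + 22 * m + 22 + 1) + 1 \<and> I ?N s) s"
    proof (rule runs_While[where I = I, OF _ _ that])
      fix j s assume j: "j < ?N" and I: "I j s"
      \<comment> \<open>Within the range the counter overflows exactly once, after its last
        value.\<close>
      have dvd: "?N dvd Suc j \<longleftrightarrow> Suc j = ?N" using j by (metis Suc_leI dvd_imp_le dvd_refl le_antisym zero_less_Suc)
      have all: "(\<forall>i<Suc j. ?z i) \<longleftrightarrow> ?z j \<and> (\<forall>i<j. ?z i)" by (auto simp: less_Suc_eq)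
      have "runs e f visit_point (\<lambda>t s'. t \<le> 5 * n + 22 * m + 22 \<and> I (Suc j) s') s"
      proof (rule runs_mono[OF runs_visit_point[of n B m s j f e]])
        show "layout n B m s" "\<forall>i < 2 * m + 1. nmem s i = j div B ^ i mod B" using I unfolding I_def by blast+
        show "f x = f y" if "\<And>v. v < n \<Longrightarrow> x v = y v" for x y by (rule loc[OF that])
      qed (use I B0 in \<open>simp_all only: I_def dvd all, auto\<close>)
      then show "holds (Less 15 11) s \<and> runs e f visit_point (\<lambda>t s'. t \<le> 5 * n + 22 * m + 22 \<and> I (Suc j) s') s"
        using I j by (simp add: I_def layout_def)
    qed (simp add: I_def layout_def)
    then show ?thesis by (simp only: add.assoc numeral_plus_one semiring_norm)
  qed
  have "runs e f identity_test (\<lambda>t s. t \<le> ?N * (5 * n + 22 * m + 23) + 6 * n + 3 * k + 17 \<and>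
    reg s 0 = (if \<forall>j < ?N. ?z j then 1 else 0)) (initial_state k d n)"
    unfolding identity_test_def runs_Seq
  proof (rule runs_mono[OF runs_compute_layout[of e f n k d]])
    fix t and s :: "'f state" assume s: "t \<le> 6 * n + 3 * k + 15 \<and> layout n (k * n * n + 1) (k * k - 1) s \<and>
      reg s 1 = 1 \<and> reg s 15 = 0 \<and> nmem s = (\<lambda>_. 0)"
    then have "I 0 s" using B0 unfolding I_def B m by simp
    show "runs e f (While (Less 15 11) visit_point) (\<lambda>u. runs e f (NatCopy 0 1)
      (\<lambda>v s. t + (u + v) \<le> ?N * (5 * n + 22 * m + 23) + 6 * n + 3 * k + 17 \<and>
         reg s 0 = (if \<forall>j < ?N. ?z j then 1 else 0))) s"
    proof (rule runs_mono[OF main[OF \<open>I 0 s\<close>]])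
      fix u s' assume s': "u \<le> ?N * (5 * n + 22 * m + 23) + 1 \<and> I ?N s'"
      then have "t + (u + 1) \<le> ?N * (5 * n + 22 * m + 23) + 6 * n + 3 * k + 17" using s by linarith
      then show "runs e f (NatCopy 0 1) (\<lambda>v s. t + (u + v) \<le> ?N * (5 * n + 22 * m + 23) + 6 * n + 3 * k + 17 \<and>
         reg s 0 = (if \<forall>j < ?N. ?z j then 1 else 0)) s'"
        using s' by (simp only: runs_simps I_def) simp
    qed
  qed
  then show ?thesis unfolding runs_def halts_with_def by blast
qed

section \<open>Running time and conclusion\<close>

text \<open>With \<open>l = log 2 k\<close> we have \<open>k = 2 powr l \<le> n powr l\<close>, so
  the base is at most \<open>n powr (l + 3)\<close>. The resulting exponent is of order
  \<open>k ^ 2 * l\<close>, which \<open>k ^ 4 * l\<close> dominates from \<open>k = 3\<close> on;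
  \<open>k = 2\<close> is computed directly.\<close>

lemma time_bound:
  assumes k: "2 \<le> k" and n: "2 \<le> n"
  shows "20 * real n * real k ^ 2 * real (k * n * n + 1) ^ (2 * (k * k - 1) + 1)
    \<le> 200000 * real n powr (real k ^ 4 * log 2 (real k))"
proof (cases "k = 2")
  case True
  have "real (k * n * n + 1) \<le> 3 * real n ^ 2"
    using mult_mono[of 1 "real n" 1 "real n"] n True by (simp add: power2_eq_square)
  then have "real (k * n * n + 1) ^ 7 \<le> (3 * real n ^ 2) ^ 7" by (rule power_mono) simp
  then have "80 * real n * real (k * n * n + 1) ^ 7 \<le> 80 * real n * (3 * real n ^ 2) ^ 7"
    by (rule mult_left_mono) simp
  \<comment> \<open>For \<open>k = 2\<close> the target exponent is 16. The numerical factor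
    \<open>80 * 3 ^ 7 = 174960\<close> accounts for the constant 200000.\<close>
  also have "\<dots> = 174960 * real n ^ 15" by (simp add: power_mult_distrib flip: power_mult power_Suc)
  also have "\<dots> \<le> 200000 * real n ^ 16" using n by (intro mult_mono power_increasing) simp_all
  also have "real n ^ 16 = real n powr 16" using n powr_realpow[of "real n" 16] by simp
  finally show ?thesis using True by simp
next
  case False
  then have k3: "3 \<le> k" using k by simp
  define l where "l = log 2 (real k)"
  have kl: "real k = 2 powr l" using k by (simp add: l_def)
  have "log 2 (2 powr (3 / 2)) \<le> l" unfolding l_def
  proof (rule log_mono)
    have "((2::real) powr (3 / 2)) ^ 2 = 2 powr 3"
      by (simp add: powr_powr flip: powr_numeral)
    also have "\<dots> \<le> (real k)\<^sup>2" using power_mono[of 3 "real k" 2] k3 by simp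
    finally show "2 powr (3 / 2) \<le> real k" by (rule power2_le_imp_le) simp
  qed simp_all
  then have l: "3 / 2 \<le> l" by simp
  have n1: "1 \<le> real n" using n by simp
  have kn: "real k \<le> real n powr l" unfolding kl using n l by (intro powr_mono2) simp_all
  have n_powr: "real n = real n powr 1" "real n ^ 2 = real n powr 2" using n1 by simp_all
  have "1 \<le> real k * real n ^ 2" using k n1 mult_mono[of 1 "real k" 1 "real n ^ 2"] by simp
  then have "real (k * n * n + 1) \<le> 2 * real k * real n ^ 2" by (simp add: power2_eq_square algebra_simps)
  also have "\<dots> \<le> real n * real n powr l * real n ^ 2"
    using kn n by (intro mult_mono) simp_all
  also have "\<dots> = real n powr 1 * real n powr l * real n powr 2" using n_powr by presburger
  also have "\<dots> = real n powr (l + 3)" unfolding powr_add[symmetric] by (simp add: add.commute)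
  finally have "real (k * n * n + 1) ^ (2 * (k * k - 1) + 1) \<le> (real n powr (l + 3)) ^ (2 * (k * k - 1) + 1)"
    by (rule power_mono) simp
  also have "\<dots> = real n powr ((l + 3) * (2 * real k ^ 2 - 1))"
  proof -
    have "1 \<le> k * k" using k by simp
    then have "real (2 * (k * k - 1) + 1) = 2 * real k ^ 2 - 1" by (simp add: of_nat_diff power2_eq_square)
    moreover have "(real n powr (l + 3)) ^ (2 * (k * k - 1) + 1) = (real n powr (l + 3)) powr real (2 * (k * k - 1) + 1)"
      using n1 by (subst powr_realpow) simp_all
    ultimately show ?thesis by (simp only: powr_powr)
  qed
  finally have B: "real (k * n * n + 1) ^ (2 * (k * k - 1) + 1) \<le> real n powr ((l + 3) * (2 * real k ^ 2 - 1))" .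
  have "real k ^ 2 \<le> (real n powr l) ^ 2" using kn by (intro power_mono) simp_all
  then have "real n * real k ^ 2 \<le> real n * (real n powr l) ^ 2" by (rule mult_left_mono) simp
  also have "\<dots> = real n powr 1 * (real n powr l * real n powr l)"
    using n_powr(1) by (simp add: power2_eq_square)
  also have "\<dots> = real n powr (1 + 2 * l)" unfolding powr_add[symmetric] by simp
  finally have A: "real n * real k ^ 2 \<le> real n powr (1 + 2 * l)" .
  have "real n * real k ^ 2 * real (k * n * n + 1) ^ (2 * (k * k - 1) + 1)
      \<le> real n powr (1 + 2 * l) * real n powr ((l + 3) * (2 * real k ^ 2 - 1))"
    by (rule mult_mono[OF A B]) simp_all
  also have "\<dots> = real n powr (1 + 2 * l + (l + 3) * (2 * real k ^ 2 - 1))" by (simp add: powr_add)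
  also have "\<dots> \<le> real n powr (real k ^ 4 * l)"
  proof (rule powr_mono[OF _ n1])
    \<comment> \<open>From \<open>3 / 2 \<le> l\<close> follows \<open>6 \<le> 4 * l\<close>, so the
      exponent is at most \<open>7 * (k ^ 2 * l)\<close>; then \<open>7 \<le> 9 \<le> k ^ 2\<close>
      gives the second factor \<open>k ^ 2\<close>.\<close>
    have k9: "9 \<le> real k ^ 2" using power_mono[of 3 "real k" 2] k3 by simp
    have "1 + 2 * l + (l + 3) * (2 * real k ^ 2 - 1) \<le> 2 * real k ^ 2 * l + real k ^ 2 * 6 + l"
      by (simp add: algebra_simps)
    also have "\<dots> \<le> 2 * real k ^ 2 * l + real k ^ 2 * (4 * l) + 1 * l"
      using l by (intro add_mono mult_left_mono) simp_all
    also have "\<dots> \<le> 2 * real k ^ 2 * l + real k ^ 2 * (4 * l) + real k ^ 2 * l"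
      using l k9 by (intro add_left_mono mult_right_mono) simp_all
    also have "\<dots> = 7 * (real k ^ 2 * l)" by simp
    also have "\<dots> \<le> real k ^ 2 * (real k ^ 2 * l)" using k9 l by (intro mult_right_mono) simp_all
    also have "\<dots> = real k ^ 4 * l" by (simp add: power4_eq_xxxx power2_eq_square)
    finally show "1 + 2 * l + (l + 3) * (2 * real k ^ 2 - 1) \<le> real k ^ 4 * l" .
  qed
  finally have "real n * real k ^ 2 * real (k * n * n + 1) ^ (2 * (k * k - 1) + 1) \<le> real n powr (real k ^ 4 * l)" .
  moreover have "0 \<le> real n powr (real k ^ 4 * l)" by simp
  ultimately have "20 * (real n * real k ^ 2 * real (k * n * n + 1) ^ (2 * (k * k - 1) + 1))
      \<le> 200000 * real n powr (real k ^ 4 * l)" by linarith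
  then show ?thesis unfolding l_def by (simp only: mult.assoc)
qed

text \<open>The setup cost is absorbed because the power of \<open>B\<close> is at least 1. Every
  summand is then compared with \<open>n * k ^ 2\<close>, using \<open>m \<le> k ^ 2\<close> and
  \<open>k, n \<ge> 2\<close>.\<close>

lemma step_count_bound:
  fixes k n B :: nat
  assumes k: "2 \<le> k" and n: "2 \<le> n" and m: "m = k * k - 1" and B: "1 \<le> B"
  shows "B ^ (2 * m + 1) * (5 * n + 22 * m + 23) + 6 * n + 3 * k + 17 \<le> 20 * n * k ^ 2 * B ^ (2 * m + 1)"
proof -
  have k4: "2 * k \<le> k ^ 2" "4 \<le> k ^ 2" using k mult_le_mono[OF k k] by (simp_all add: power2_eq_square)
  have nk: "4 * n \<le> n * k ^ 2" "2 * k ^ 2 \<le> n * k ^ 2" using mult_le_mono2[OF k4(2), of n] mult_le_mono1[OF n, of "k ^ 2"] by simp_all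
  have "5 * n + 22 * m + 23 + (6 * n + 3 * k + 17) \<le> 20 * (n * k ^ 2)"
  proof -
    have "m \<le> k ^ 2" by (simp add: m power2_eq_square)
    with nk k4 show ?thesis by linarith
  qed
  then have "B ^ (2 * m + 1) * (5 * n + 22 * m + 23 + (6 * n + 3 * k + 17)) \<le> B ^ (2 * m + 1) * (20 * (n * k ^ 2))"
    by (rule mult_le_mono2)
  moreover have "1 * (6 * n + 3 * k + 17) \<le> B ^ (2 * m + 1) * (6 * n + 3 * k + 17)"
    by (rule mult_le_mono1) (use B in simp)
  ultimately show ?thesis by (simp add: algebra_simps)
qed

theorem theorem3:
  shows "\<exists>(P :: com) (C :: real) (N :: nat \<Rightarrow> nat \<Rightarrow> nat).
    (\<forall>k n. 2 \<le> k \<longrightarrow> 2 \<le> n \<longrightarrow>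
       real (N k n) \<le> C * real n powr (real k ^ 4 * log 2 (real k))) \<and>
    (\<forall>k d n (c :: 'a::field depth3_circuit) (\<iota> :: 'a \<Rightarrow> 'b::field) (e :: nat \<Rightarrow> 'b).
       1 \<le> k \<longrightarrow> 1 \<le> n \<longrightarrow> read_at_most k k d n c \<longrightarrow>
       field_embedding \<iota> \<longrightarrow> inj_on e {..<N k n} \<longrightarrow>
       (\<exists>t. halts_with e (meval \<iota> (circuit_poly k d n c)) P k d n t (circuit_poly k d n c = 0) \<and>
            (2 \<le> k \<longrightarrow> 2 \<le> n \<longrightarrow>
               real t \<le> C * real n powr (real k ^ 4 * log 2 (real k)))))"
proof -
  let ?C = "200000 :: real" and ?N = "\<lambda>k n. k * n * n + 1 :: nat"
  have steps: "real (?N k n ^ (2 * (k * k - 1) + 1) * (5 * n + 22 * (k * k - 1) + 23) + 6 * n + 3 * k + 17)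
      \<le> ?C * real n powr (real k ^ 4 * log 2 (real k))" if "2 \<le> k" "2 \<le> n" for k n
  proof -
    have "real (?N k n ^ (2 * (k * k - 1) + 1) * (5 * n + 22 * (k * k - 1) + 23) + 6 * n + 3 * k + 17)
        \<le> real (20 * n * k ^ 2 * ?N k n ^ (2 * (k * k - 1) + 1))"
      by (subst of_nat_le_iff, rule step_count_bound[OF that refl]) simp
    also have "\<dots> = 20 * real n * real k ^ 2 * real (?N k n) ^ (2 * (k * k - 1) + 1)"
      by (simp only: of_nat_mult of_nat_power of_nat_numeral)
    also have "\<dots> \<le> ?C * real n powr (real k ^ 4 * log 2 (real k))" by (rule time_bound[OF that])
    finally show ?thesis .
  qed
  \<comment> \<open>The number of required field elements is the base of the digit counter, hence
    already below the step bound.\<close>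
  have elems: "real (?N k n) \<le> ?C * real n powr (real k ^ 4 * log 2 (real k))" if kn: "2 \<le> k" "2 \<le> n" for k n
  proof -
    have "?N k n ^ 1 \<le> ?N k n ^ (2 * (k * k - 1) + 1)" by (rule power_increasing) simp_all
    also have "\<dots> * 1 \<le> \<dots> * (5 * n + 22 * (k * k - 1) + 23)" by (rule mult_le_mono2) simp
    finally have "?N k n \<le> ?N k n ^ (2 * (k * k - 1) + 1) * (5 * n + 22 * (k * k - 1) + 23) + 6 * n + 3 * k + 17"
      by simp
    then show ?thesis using steps[OF kn] by (meson of_nat_le_iff order_trans)
  qed
  have "\<exists>t. halts_with e (meval \<iota> (circuit_poly k d n c)) identity_test k d n t (circuit_poly k d n c = 0) \<and>
      (2 \<le> k \<longrightarrow> 2 \<le> n \<longrightarrow> real t \<le> ?C * real n powr (real k ^ 4 * log 2 (real k)))"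
    if k: "1 \<le> k" and n: "1 \<le> n" and rd: "read_at_most k k d n c"
      and \<iota>: "field_embedding \<iota>" and e: "inj_on e {..<?N k n}"
    for k d n and c :: "'a depth3_circuit" and \<iota> :: "'a \<Rightarrow> 'b" and e :: "nat \<Rightarrow> 'b"
  proof -
    let ?f = "meval \<iota> (circuit_poly k d n c)"
    have loc: "?f x = ?f y" if "\<And>v. v < n \<Longrightarrow> x v = y v" for x y
      unfolding meval_circuit_poly[OF \<iota>] using lin_cong[of n x y, OF that] by simp
    obtain t where t: "halts_with e ?f identity_test k d n t (\<forall>j < ?N k n ^ (2 * (k * k - 1) + 1).
        ?f (test_point e (k * k - 1) (\<lambda>i. j div ?N k n ^ i mod ?N k n)) = 0)"
      "t \<le> ?N k n ^ (2 * (k * k - 1) + 1) * (5 * n + 22 * (k * k - 1) + 23) + 6 * n + 3 * k + 17"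
      using halts_with_identity_test[where f = ?f and k = k and n = n and d = d and e = e, OF refl refl loc]
      by blast
    have "real t \<le> ?C * real n powr (real k ^ 4 * log 2 (real k))" if "2 \<le> k" "2 \<le> n"
      using t(2) steps[OF that] by (meson of_nat_le_iff order_trans)
    then show ?thesis
      using t(1) unfolding circuit_zero_iff_test_points[OF k n rd \<iota> refl e refl] by blast
  qed
  with elems show ?thesis by (intro exI[of _ identity_test] exI[of _ ?C] exI[of _ ?N]) blast
qed

end
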